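(* Let $n\geq 3$. There is no polynomial $f\in\mathbb{R}[x,y]$ of degree $n$, with homogeneous part of degree $n$ denoted $f_n$, such that all of the following hold: (1) all the real factors of $f_n$ are simple; (2) the graph $S^n_f=\{(x,y,z)\in\mathbb{R}^3 : z=f(x,y)\}$ is a generic surface; (3) the parabolic curve of $S^n_f$ is connected and compact; (4) the parabolic curve of $S^n_f$ contains exactly one special parabolic point, and this point has index $+1$; (5) the set of hyperbolic points of $S^n_f$ is unbounded.
   Context: Write $f=\sum_{i=0}^n f_i$ with $f_i\in\mathbb{R}[x,y]$ homogeneous of degree $i$. "All real factors of $f_n$ are simple" means that every irreducible factor of $f_n$ in $\mathbb{R}[x,y]$ has multiplicity one. Point types. Points of $S^n_f$ are identified with their projections to the $xy$-plane. Let $\mathrm{Hess}(f)=f_{xx}f_{yy}-f_{xy}^2$ and $II_f=f_{xx}\,dx^2+2f_{xy}\,dx\,dy+f_{yy}\,dy^2$. The set of hyperbolic points is $\{\mathrm{Hess}(f)<0\}$, the set of elliptic points is $\{\mathrm{Hess}(f)>0\}$, and the parabolic curve (Hessian curve) is $\{\mathrm{Hess}(f)=0\}\subset\mathbb{R}^2$. A direction $v\neq 0$ at $q$ is asymptotic if $II_f(q)(v,v)=0$ (equivalently, the tangent line to the surface in that direction has order of contact greater than two). Hyperbolic points have two asymptotic directions. Parabolic points with $II_f\neq 0$ have exactly one. A special parabolic point is a point of the parabolic curve at which the unique asymptotic direction is tangent to the parabolic curve. Generic surfaces. The points of a surface are classified by the orders of contact with their asymptotic lines: elliptic (no asymptotic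 line); generic parabolic and special parabolic (a unique asymptotic line, of contact order three, respectively four); hyperbolic of several kinds (two asymptotic lines, with contact orders $(3,3)$, $(4,4)$, $(3,4)$ or $(3,5)$). These contact conditions define submanifolds of positive codimension, and $S^n_f$ is called generic in the space of graphs of polynomials of degree $n$ if it is transverse to each of these submanifolds. The properties of a generic surface relevant here, which may be taken as the meaning of "generic", are: $II_f$ vanishes at no point; the gradient of $\mathrm{Hess}(f)$ vanishes at no point of the Hessian curve, so the parabolic curve is a smooth curve and is the common boundary of the hyperbolic and elliptic sets; the special parabolic points are isolated on the parabolic curve; and at each special parabolic point the vector field $\xi$ described next has a nondegenerate singular point that is a saddle, a node or a focus. Index of a special parabolic point. Let $M=\{(q,[v])\in\mathbb{R}^2\times\mathbb{R}P^1 : II_f(q)(v,v)=0\}$ be the surface of asymptotic directions, which is smooth near the parabolic points. The asymptotic directions lift to a direction field on $M$. In the chart $v=(1,p)$, with $F(x,y,p)=f_{xx}+2pf_{xy}+p^2f_{yy}$ and $M=\{F=0\}$, it is spanned by $\xi=F_p\,\partial_x+pF_p\,\partial_y-(F_x+pF_y)\,\partial_p$ (and similarly in the other chart). A special parabolic point lifts to a singular point of $\xi$ on $M$. The index of the special parabolic point is $-1$ if this singular point is a saddle and $+1$ if it is a node or a focus. *)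

theory Defs
  imports "HOL-Analysis.Analysis" "HOL-Computational_Algebra.Polynomial"
begin

section \<open>Polynomials in two variables\<close>

text \<open>
  The ring \<open>\<real>[x,y]\<close> is rendered as \<open>\<real>[x][y]\<close>: the inner variable is \<open>x\<close>, the outer one is \<open>y\<close>,
  so the coefficient of \<open>x^i y^j\<close> in \<open>f\<close> is \<open>coeff (coeff f j) i\<close>.
\<close>

type_synonym bipoly = "real poly poly"

definition eval2 :: "bipoly \<Rightarrow> real \<times> real \<Rightarrow> real" where
  "eval2 f q = poly (poly f [:snd q:]) (fst q)"

definition dx :: "bipoly \<Rightarrow> bipoly" where
  "dx f = map_poly pderiv f"

definition dy :: "bipoly \<Rightarrow> bipoly" where
  "dy f = pderiv f"

text \<open>The supremum of the empty set of natural numbers is 0, so the zero polynomial gets degree 0.\<close>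

definition total_degree :: "bipoly \<Rightarrow> nat" where
  "total_degree f = Sup {i + j | i j. coeff (coeff f j) i \<noteq> 0}"

definition hom_part :: "nat \<Rightarrow> bipoly \<Rightarrow> bipoly" where
  "hom_part k f = (\<Sum>j\<le>k. monom (monom (coeff (coeff f j) (k - j)) (k - j)) j)"

definition simple_real_factors :: "bipoly \<Rightarrow> bool" where
  "simple_real_factors g \<longleftrightarrow> (\<forall>p. irreducible p \<and> p dvd g \<longrightarrow> \<not> p\<^sup>2 dvd g)"


section \<open>Second fundamental form, Hessian and asymptotic directions\<close>

text \<open>Points of the graph of \<open>f\<close> are identified with their projections to the \<open>xy\<close>-plane.\<close>

definition second_form :: "bipoly \<Rightarrow> real \<times> real \<Rightarrow> real \<times> real \<Rightarrow> real" where
  "second_form f q v =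
     eval2 (dx (dx f)) q * (fst v)\<^sup>2 + 2 * eval2 (dx (dy f)) q * fst v * snd v
       + eval2 (dy (dy f)) q * (snd v)\<^sup>2"

definition hess :: "bipoly \<Rightarrow> bipoly" where
  "hess f = dx (dx f) * dy (dy f) - (dx (dy f))\<^sup>2"

definition hess_gradient :: "bipoly \<Rightarrow> real \<times> real \<Rightarrow> real \<times> real" where
  "hess_gradient f q = (eval2 (dx (hess f)) q, eval2 (dy (hess f)) q)"

definition hyperbolic_points :: "bipoly \<Rightarrow> (real \<times> real) set" where
  "hyperbolic_points f = {q. eval2 (hess f) q < 0}"

definition parabolic_curve :: "bipoly \<Rightarrow> (real \<times> real) set" where
  "parabolic_curve f = {q. eval2 (hess f) q = 0}"

definition asymptotic_direction :: "bipoly \<Rightarrow> real \<times> real \<Rightarrow> real \<times> real \<Rightarrow> bool" where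
  "asymptotic_direction f q v \<longleftrightarrow> v \<noteq> 0 \<and> second_form f q v = 0"

text \<open>
  The tangent line at \<open>q\<close> of the curve \<open>{Hess(f) = 0}\<close> is the kernel of the differential of \<open>Hess(f)\<close>;
  this is used only for surfaces on which that differential vanishes nowhere along the curve.
\<close>

definition tangent_to_parabolic_curve :: "bipoly \<Rightarrow> real \<times> real \<Rightarrow> real \<times> real \<Rightarrow> bool" where
  "tangent_to_parabolic_curve f q v \<longleftrightarrow> hess_gradient f q \<bullet> v = 0"

definition special_parabolic_points :: "bipoly \<Rightarrow> (real \<times> real) set" where
  "special_parabolic_points f =
     {q \<in> parabolic_curve f.
        \<exists>v. asymptotic_direction f q v \<and> (\<forall>w. asymptotic_direction f q w \<longrightarrow> w \<in> span {v})
          \<and> tangent_to_parabolic_curve f q v}"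


section \<open>Nondegenerate singular points of a vector field on a level surface\<close>

text \<open>
  Let \<open>X\<close> be a vector field on the ambient space that is tangent to \<open>{F = 0}\<close> and vanishes at \<open>z\<close>.
  Then its derivative at \<open>z\<close> maps the tangent space \<open>ker dF(z)\<close> into itself.  The complex eigenvalues
  of this restriction are described through their eigenvectors \<open>u + \<i> w\<close> in the
  complexified tangent space.
\<close>

definition sing_eigenvalues ::
    "('a::real_normed_vector \<Rightarrow> real) \<Rightarrow> ('a \<Rightarrow> 'a) \<Rightarrow> 'a \<Rightarrow> complex set" where
  "sing_eigenvalues F X z =
     (let T = {w. frechet_derivative F (at z) w = 0}; D = frechet_derivative X (at z)
      in {\<mu>. \<exists>u\<in>T. \<exists>w\<in>T. (u \<noteq> 0 \<or> w \<noteq> 0)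
             \<and> D u = Re \<mu> *\<^sub>R u - Im \<mu> *\<^sub>R w
             \<and> D w = Im \<mu> *\<^sub>R u + Re \<mu> *\<^sub>R w})"

definition singular_point_on ::
    "('a::real_normed_vector \<Rightarrow> real) \<Rightarrow> ('a \<Rightarrow> 'a) \<Rightarrow> 'a \<Rightarrow> bool" where
  "singular_point_on F X z \<longleftrightarrow> F z = 0 \<and> X z = 0"

definition saddle_on ::
    "('a::real_normed_vector \<Rightarrow> real) \<Rightarrow> ('a \<Rightarrow> 'a) \<Rightarrow> 'a \<Rightarrow> bool" where
  "saddle_on F X z \<longleftrightarrow> singular_point_on F X z
     \<and> (\<exists>\<mu>\<in>sing_eigenvalues F X z. Im \<mu> = 0 \<and> Re \<mu> < 0)
     \<and> (\<exists>\<nu>\<in>sing_eigenvalues F X z. Im \<nu> = 0 \<and> 0 < Re \<nu>)"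

text \<open>Nodes with a double eigenvalue, diagonalizable or not, are included.\<close>

definition node_on ::
    "('a::real_normed_vector \<Rightarrow> real) \<Rightarrow> ('a \<Rightarrow> 'a) \<Rightarrow> 'a \<Rightarrow> bool" where
  "node_on F X z \<longleftrightarrow> singular_point_on F X z
     \<and> ((\<forall>\<mu>\<in>sing_eigenvalues F X z. Im \<mu> = 0 \<and> 0 < Re \<mu>)
       \<or> (\<forall>\<mu>\<in>sing_eigenvalues F X z. Im \<mu> = 0 \<and> Re \<mu> < 0))"

definition focus_on ::
    "('a::real_normed_vector \<Rightarrow> real) \<Rightarrow> ('a \<Rightarrow> 'a) \<Rightarrow> 'a \<Rightarrow> bool" where
  "focus_on F X z \<longleftrightarrow> singular_point_on F X z
     \<and> (\<exists>\<mu>\<in>sing_eigenvalues F X z. Im \<mu> \<noteq> 0 \<and> Re \<mu> \<noteq> 0)"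


section \<open>The lifted field of asymptotic directions and the index\<close>

text \<open>
  The surface of asymptotic directions in the two affine charts \<open>v = (1,p)\<close> and \<open>v = (p,1)\<close> of the
  projective line, with the vector field spanning the lifted direction field in each chart.
  The second field is the first one with the roles of \<open>x\<close> and \<open>y\<close> exchanged.
\<close>

definition asym1 :: "bipoly \<Rightarrow> real \<times> real \<times> real \<Rightarrow> real" where
  "asym1 f = (\<lambda>(x, y, p). second_form f (x, y) (1, p))"

definition asym2 :: "bipoly \<Rightarrow> real \<times> real \<times> real \<Rightarrow> real" where
  "asym2 f = (\<lambda>(x, y, p). second_form f (x, y) (p, 1))"

definition xi1 :: "bipoly \<Rightarrow> real \<times> real \<times> real \<Rightarrow> real \<times> real \<times> real" where
  "xi1 f = (\<lambda>(x, y, p).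
     let Fx = deriv (\<lambda>s. asym1 f (s, y, p)) x;
         Fy = deriv (\<lambda>s. asym1 f (x, s, p)) y;
         Fp = deriv (\<lambda>s. asym1 f (x, y, s)) p
     in (Fp, p * Fp, - (Fx + p * Fy)))"

definition xi2 :: "bipoly \<Rightarrow> real \<times> real \<times> real \<Rightarrow> real \<times> real \<times> real" where
  "xi2 f = (\<lambda>(x, y, p).
     let Fx = deriv (\<lambda>s. asym2 f (s, y, p)) x;
         Fy = deriv (\<lambda>s. asym2 f (x, s, p)) y;
         Fp = deriv (\<lambda>s. asym2 f (x, y, s)) p
     in (p * Fp, Fp, - (Fy + p * Fx)))"

text \<open>
  On the overlap of the charts the two fields are proportional, with a nonvanishing (possibly
  negative) factor, so the type of a singular point does not depend on the chart.
\<close>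

definition lifts_to_saddle :: "bipoly \<Rightarrow> real \<times> real \<Rightarrow> bool" where
  "lifts_to_saddle f q \<longleftrightarrow>
     (\<exists>p. saddle_on (asym1 f) (xi1 f) (fst q, snd q, p)
        \<or> saddle_on (asym2 f) (xi2 f) (fst q, snd q, p))"

definition lifts_to_node :: "bipoly \<Rightarrow> real \<times> real \<Rightarrow> bool" where
  "lifts_to_node f q \<longleftrightarrow>
     (\<exists>p. node_on (asym1 f) (xi1 f) (fst q, snd q, p)
        \<or> node_on (asym2 f) (xi2 f) (fst q, snd q, p))"

definition lifts_to_focus :: "bipoly \<Rightarrow> real \<times> real \<Rightarrow> bool" where
  "lifts_to_focus f q \<longleftrightarrow>
     (\<exists>p. focus_on (asym1 f) (xi1 f) (fst q, snd q, p)
        \<or> focus_on (asym2 f) (xi2 f) (fst q, snd q, p))"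

text \<open>The value 0 stands for an undefined index; it does not occur on generic surfaces.\<close>

definition special_index :: "bipoly \<Rightarrow> real \<times> real \<Rightarrow> int" where
  "special_index f q =
     (if lifts_to_saddle f q then -1
      else if lifts_to_node f q \<or> lifts_to_focus f q then 1
      else 0)"


section \<open>Generic graphs\<close>

definition generic_graph :: "bipoly \<Rightarrow> bool" where
  "generic_graph f \<longleftrightarrow>
     (\<forall>q. \<exists>v. second_form f q v \<noteq> 0)
     \<and> (\<forall>q\<in>parabolic_curve f. hess_gradient f q \<noteq> 0)
     \<and> discrete (special_parabolic_points f)
     \<and> (\<forall>q\<in>special_parabolic_points f.
          lifts_to_saddle f q \<or> lifts_to_node f q \<or> lifts_to_focus f q)"

end

theory Submission
  imports Defs "HOL-Complex_Analysis.Complex_Analysis"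
begin

text \<open>
  Let \<open>h = Hess(f)\<close>, let \<open>D\<close> be the region \<open>h > 0\<close> bounded by the parabolic curve \<open>S\<close>, and let
  \<open>w = f_xx - f_yy + 2 i f_xy\<close> and \<open>\<tau> = f_xx + f_yy\<close>.  The function \<open>w\<close> has no zero where \<open>h \<le> 0\<close>, so its
  winding number along \<open>S\<close> is the one along a large circle, where \<open>w\<close> may be replaced by the
  corresponding function of \<open>f_n\<close>.  Writing \<open>f_n = r^n F(t)\<close>, that function is homotopic to
  \<open>e^(2it) (F + i F')\<close>.  Its winding number is \<open>2 - k\<close> if \<open>f_n\<close> has \<open>k\<close> real linear factors, because every
  zero of \<open>F\<close> lowers the argument of \<open>F + i F'\<close> by \<open>\<pi>\<close>.  A hyperbolic form with simple factors has
  \<open>k \<ge> 2\<close>, so the winding number of \<open>w\<close> is at most 0.  On the other hand the gradient \<open>N\<close> of \<open>h\<close> has winding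
  number 1 along \<open>S\<close>.  Hence \<open>w / (\<tau> N\<^sup>2)\<close> has winding number at most \<open>-2\<close> and takes positive real values
  at two or more points of \<open>S\<close>.  These are special parabolic points, so there cannot be only
  one, whatever its index.  No parametrization of \<open>S\<close> is used: winding numbers are compared through
  the existence of continuous logarithms.
\<close>

section \<open>Continuous logarithms\<close>

text \<open>For nonvanishing continuous functions on a closed curve this encodes winding number 0
  without a parametrization; equal winding numbers mean that the quotient has a logarithm.\<close>

definition has_log :: "'a::topological_space set \<Rightarrow> ('a \<Rightarrow> complex) \<Rightarrow> bool" where
  "has_log S g \<longleftrightarrow> (\<exists>\<phi>. continuous_on S \<phi> \<and> (\<forall>x\<in>S. g x = exp (\<phi> x)))"

lemma has_logI: "continuous_on S \<phi> \<Longrightarrow> (\<And>x. x \<in> S \<Longrightarrow> g x = exp (\<phi> x)) \<Longrightarrow> has_log S g"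
  by (auto simp: has_log_def)

lemma has_logE:
  assumes "has_log S g"
  obtains \<phi> where "continuous_on S \<phi>" "\<And>x. x \<in> S \<Longrightarrow> g x = exp (\<phi> x)"
  using assms by (auto simp: has_log_def)

lemma has_log_cong: "has_log S f \<Longrightarrow> (\<And>x. x \<in> S \<Longrightarrow> g x = f x) \<Longrightarrow> has_log S g"
  by (auto simp: has_log_def)

lemma has_log_subset: "has_log S f \<Longrightarrow> T \<subseteq> S \<Longrightarrow> has_log T f"
  unfolding has_log_def by (meson continuous_on_subset subsetD)

lemma has_log_mult:
  assumes "has_log S f" "has_log S g"
  shows "has_log S (\<lambda>x. f x * g x)"
proof -
  obtain \<phi> \<psi> where "continuous_on S \<phi>" "\<And>x. x \<in> S \<Longrightarrow> f x = exp (\<phi> x)"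
      "continuous_on S \<psi>" "\<And>x. x \<in> S \<Longrightarrow> g x = exp (\<psi> x)"
    using assms by (metis has_logE)
  then show ?thesis
    by (intro has_logI[of _ "\<lambda>x. \<phi> x + \<psi> x"]) (auto intro: continuous_intros simp: exp_add)
qed

lemma has_log_divide:
  assumes "has_log S f" "has_log S g"
  shows "has_log S (\<lambda>x. f x / g x)"
proof -
  obtain \<phi> \<psi> where "continuous_on S \<phi>" "\<And>x. x \<in> S \<Longrightarrow> f x = exp (\<phi> x)"
      "continuous_on S \<psi>" "\<And>x. x \<in> S \<Longrightarrow> g x = exp (\<psi> x)"
    using assms by (metis has_logE)
  then show ?thesis
    by (intro has_logI[of _ "\<lambda>x. \<phi> x - \<psi> x"]) (auto intro: continuous_intros simp: exp_diff)
qed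

lemma has_log_power:
  assumes "has_log S f"
  shows "has_log S (\<lambda>x. f x ^ n)"
proof -
  obtain \<phi> where "continuous_on S \<phi>" "\<And>x. x \<in> S \<Longrightarrow> f x = exp (\<phi> x)"
    using assms by (metis has_logE)
  then show ?thesis
    by (intro has_logI[of _ "\<lambda>x. of_nat n * \<phi> x"]) (auto intro: continuous_intros simp: exp_of_nat_mult)
qed

lemma has_log_const: "c \<noteq> 0 \<Longrightarrow> has_log S (\<lambda>x. c)"
  by (intro has_logI[of _ "\<lambda>x. Ln c"]) auto

lemma has_log_avoiding_nonpos_Reals:
  assumes "continuous_on S f" "\<And>x. x \<in> S \<Longrightarrow> f x \<notin> \<real>\<^sub>\<le>\<^sub>0"
  shows "has_log S f"
proof (rule has_logI)
  show "continuous_on S (\<lambda>x. Ln (f x))"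
    using assms by (intro continuous_intros) auto
  show "f x = exp (Ln (f x))" if "x \<in> S" for x
    using assms(2)[OF that] by (cases "f x = 0") auto
qed

text \<open>Division by \<open>-c\<close> turns the missed ray into the nonpositive real axis. Used
  contrapositively: a continuous map without a logarithm meets every ray from 0.\<close>

lemma has_log_misses_ray:
  assumes "continuous_on S f" "c \<noteq> 0" "\<And>x r. x \<in> S \<Longrightarrow> 0 \<le> r \<Longrightarrow> f x \<noteq> of_real r * c"
  shows "has_log S f"
proof -
  have "has_log S (\<lambda>x. f x / - c)"
  proof (rule has_log_avoiding_nonpos_Reals)
    show "continuous_on S (\<lambda>x. f x / - c)"
      using assms by (intro continuous_intros) auto
    fix x assume x: "x \<in> S"
    show "f x / - c \<notin> \<real>\<^sub>\<le>\<^sub>0"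
    proof
      assume "f x / - c \<in> \<real>\<^sub>\<le>\<^sub>0"
      then obtain r where "r \<le> 0" "f x / - c = of_real r"
        by (metis nonpos_Reals_cases)
      then have "f x = of_real (-r) * c" "0 \<le> -r"
        using assms(2) by (auto simp: field_simps) (metis minus_minus)
      then show False using assms(3)[OF x] by blast
    qed
  qed
  from has_log_mult[OF this has_log_const[of "-c"]] show ?thesis
    by (rule has_log_cong) (use assms(2) in auto)
qed

lemma has_log_of_real:
  assumes "connected S" "continuous_on S f" "\<And>x. x \<in> S \<Longrightarrow> f x \<noteq> (0::real)"
  shows "has_log S (\<lambda>x. complex_of_real (f x))"
proof -
  have "is_interval (f ` S)"
    using connected_continuous_image[OF assms(2,1)] by (simp add: is_interval_connected_1)
  then have "(\<forall>x\<in>S. f x > 0) \<or> (\<forall>x\<in>S. f x < 0)"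
    unfolding is_interval_1 using assms(3) by (smt (verit) image_iff)
  then show ?thesis
  proof
    assume "\<forall>x\<in>S. f x > 0"
    then show ?thesis
      by (intro has_log_avoiding_nonpos_Reals continuous_intros assms) (auto simp: not_le)
  next
    assume "\<forall>x\<in>S. f x < 0"
    then have "has_log S (\<lambda>x. complex_of_real (- f x))"
      by (intro has_log_avoiding_nonpos_Reals continuous_intros assms) (auto simp: not_le simp del: of_real_minus)
    from has_log_mult[OF this has_log_const[of "-1"]] show ?thesis by simp
  qed
qed

text \<open>Division by the initial map gives a homotopy starting at the constant 1 in the punctured
  plane, and inessential maps have logarithms.\<close>

lemma has_log_homotopy:
  fixes S :: "'a::real_normed_vector set"
  assumes G: "continuous_on ({0..1::real} \<times> S) G" and nz: "\<And>t x. t \<in> {0..1} \<Longrightarrow> x \<in> S \<Longrightarrow> G (t,x) \<noteq> 0"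
  shows "has_log S (\<lambda>x. G (1,x) / G (0,x))"
proof -
  have c0: "continuous_on ({0..1::real} \<times> S) (\<lambda>p. G (0, snd p))"
    by (rule continuous_on_compose2[OF G]) (auto intro!: continuous_intros)
  have "homotopic_with_canon (\<lambda>h. True) S (-{0}) (\<lambda>x. G (0,x) / G (0,x)) (\<lambda>x. G (1,x) / G (0,x))"
    unfolding homotopic_with_def
    by (rule exI[of _ "\<lambda>p. G p / G (0, snd p)"])
      (auto simp: nz intro!: continuous_intros G c0)
  then have "homotopic_with_canon (\<lambda>h. True) S (-{0}) (\<lambda>x. G (1,x) / G (0,x)) (\<lambda>x. 1)"
    apply (rule homotopic_with_symD[OF homotopic_with_eq])
    by (auto simp: nz)
  then show ?thesis
    using inessential_eq_continuous_logarithm[of S "\<lambda>x. G (1,x) / G (0,x)"]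
    unfolding has_log_def by blast
qed

lemma has_log_segment:
  fixes S :: "'a::real_normed_vector set"
  assumes "continuous_on S f" "continuous_on S g"
    and "\<And>t x. 0 \<le> t \<Longrightarrow> t \<le> 1 \<Longrightarrow> x \<in> S \<Longrightarrow> of_real (1 - t) * f x + of_real t * g x \<noteq> (0::complex)"
  shows "has_log S (\<lambda>x. g x / f x)"
proof -
  have *: "continuous_on ({0..1::real} \<times> S) (\<lambda>p. f (snd p))" "continuous_on ({0..1::real} \<times> S) (\<lambda>p. g (snd p))"
    by (rule continuous_on_compose2[OF assms(1)] continuous_on_compose2[OF assms(2)]; auto intro: continuous_intros)+
  have "has_log S (\<lambda>x. (\<lambda>p. of_real (1 - fst p) * f (snd p) + of_real (fst p) * g (snd p)) (1::real,x)
      / (\<lambda>p. of_real (1 - fst p) * f (snd p) + of_real (fst p) * g (snd p)) (0::real,x))"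
    by (rule has_log_homotopy) (use assms(3) in \<open>auto intro!: continuous_intros *\<close>)
  then show ?thesis by simp
qed

text \<open>The inversion \<open>z \<mapsto> 1 / (z - a)\<close> maps the complement of \<open>D\<close>, with the point at infinity added, to a
  compact set with connected complement; nonvanishing functions have logarithms there.  The
  logarithm on the circle serves to continue \<open>W\<close> over the outside of the disc.\<close>

lemma has_log_transport_inwards:
  fixes D :: "complex set"
  assumes D: "open D" "connected D" "a \<in> D" "D \<subseteq> ball 0 R"
    and W: "continuous_on (cball 0 R - D) W" "\<And>z. z \<in> cball 0 R - D \<Longrightarrow> W z \<noteq> 0"
    and log: "has_log (sphere 0 R) W"
  shows "has_log (cball 0 R - D) W"
proof -
  obtain \<phi> where \<phi>: "continuous_on (sphere 0 R) \<phi>" "\<And>z. z \<in> sphere 0 R \<Longrightarrow> W z = exp (\<phi> z)"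
    using log by (metis has_logE)
  define \<iota> where "\<iota> = (\<lambda>y. a + 1 / y)"
  define j where "j = (\<lambda>z. 1 / (z - a))"
  have \<iota>j: "\<iota> (j z) = z" "j z \<noteq> 0" if "z \<noteq> a" for z using that by (auto simp: \<iota>_def j_def)
  have j\<iota>: "j (\<iota> y) = y" "\<iota> y \<noteq> a" if "y \<noteq> 0" for y using that by (auto simp: \<iota>_def j_def)
  have cont_\<iota>: "continuous_on S \<iota>" if "0 \<notin> S" for S
    unfolding \<iota>_def using that by (intro continuous_intros) auto
  have cont_j: "continuous_on S j" if "a \<notin> S" for S
    unfolding j_def using that by (intro continuous_intros) auto
  define K where "K = j ` (cball 0 R - D)"
  \<comment> \<open>The image of the outside of the disc, with 0 in the place of infinity. As
    \<open>1 / 0 = 0\<close> gives \<open>\<iota> 0 = a\<close>, the point 0 has to be added by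
    hand.\<close>
  define B where "B = {y. y = 0 \<or> R \<le> cmod (\<iota> y)}"
  have a_lt: "cmod a < R" using D by auto
  then have R: "0 < R" by (smt (verit) norm_ge_zero)
  have "B = {y. R * cmod y \<le> cmod (a * y + 1)}"
  proof -
    have "(R \<le> cmod (\<iota> y)) = (R * cmod y \<le> cmod (a * y + 1))" if "y \<noteq> 0" for y
    proof -
      have "\<iota> y = (a * y + 1) / y" using that by (simp add: \<iota>_def field_simps)
      then have "cmod (\<iota> y) = cmod (a * y + 1) / cmod y" by (simp add: norm_divide)
      then show ?thesis using that by (simp add: pos_le_divide_eq)
    qed
    then have "y \<in> B \<longleftrightarrow> R * cmod y \<le> cmod (a * y + 1)" for y
      by (cases "y = 0") (simp_all add: B_def)
    then show ?thesis by blast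
  qed
  then have "closed B"
    by (auto intro!: closed_Collect_le continuous_intros)
  have "compact (cball 0 R - D)" using D by (simp add: compact_diff)
  then have "compact K"
    unfolding K_def using D by (intro compact_continuous_image cont_j) auto
  \<comment> \<open>What the inverted picture misses is the image of the punctured region, which is
    connected; the separation theorem asks for this.\<close>
  have KB: "K \<union> B = - j ` (D - {a})"
  proof -
    have "y \<in> j ` (D - {a})" if "y \<notin> K" "y \<notin> B" for y
    proof -
      have "y \<noteq> 0" "cmod (\<iota> y) < R" using that by (auto simp: B_def)
      moreover then have "\<iota> y \<in> D" using that j\<iota> unfolding K_def
        by (metis (no_types, lifting) DiffI image_eqI less_imp_le mem_cball_0)
      ultimately show ?thesis using j\<iota> by (metis DiffI empty_iff image_eqI insert_iff)
    qed
    moreover have "j z \<notin> K \<and> j z \<notin> B" if "z \<in> D" "z \<noteq> a" for z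
    proof -
      have "j z \<notin> K"
        unfolding K_def using \<iota>j that D by (metis (no_types, lifting) DiffE imageE)
      moreover have "j z \<notin> B"
        using \<iota>j that D by (auto simp: B_def)
      ultimately show ?thesis by simp
    qed
    ultimately show ?thesis by auto
  qed
  have "connected (D - {a})"
    using connected_open_delete[OF D(1,2)] by simp
  then have conn: "connected (- (K \<union> B))"
    unfolding KB by (auto intro!: connected_continuous_image cont_j)
  obtain e where e: "e > 0" "ball a e \<subseteq> D" using D by (metis openE)
  have "bounded (K \<union> B)"
  proof (rule boundedI)
    fix y assume "y \<in> K \<union> B"
    show "cmod y \<le> 1 / e"
    proof (rule ccontr)
      assume n: "\<not> cmod y \<le> 1 / e"
      then have y0: "y \<noteq> 0" using e by auto
      have "cmod (1/y) < e" using n e y0 by (simp add: norm_divide field_simps)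
      then have "\<iota> y \<in> D" using e by (auto simp: \<iota>_def dist_norm norm_divide)
      then have "y \<in> j ` (D - {a})" using j\<iota>[OF y0] by (metis DiffI empty_iff image_eqI insert_iff)
      then show False using KB \<open>y \<in> K \<union> B\<close> by auto
    qed
  qed
  moreover have "closed (K \<union> B)" using \<open>closed B\<close> \<open>compact K\<close> by (simp add: closed_Un compact_imp_closed)
  ultimately have "compact (K \<union> B)" by (simp add: compact_eq_bounded_closed)
  then have Bors: "Borsukian (K \<union> B)" using conn Borsukian_separation_compact by blast
  have "continuous_on (j ` sphere 0 R) (\<lambda>y. \<phi> (\<iota> y))"
  proof (rule continuous_on_compose2[OF \<phi>(1) cont_\<iota>])
    show "0 \<notin> j ` sphere 0 R" using \<iota>j a_lt by (auto simp: j_def)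
    show "\<iota> ` (j ` sphere 0 R) \<subseteq> sphere 0 R" using \<iota>j a_lt
      by (smt (verit, best) dist_norm image_iff image_subset_iff mem_sphere_0 norm_minus_cancel)
  qed
  moreover have "closed (j ` sphere 0 R)"
    by (intro compact_imp_closed compact_continuous_image cont_j) (use a_lt in auto)
  ultimately obtain \<Phi> where \<Phi>: "continuous_on UNIV \<Phi>" "\<And>y. y \<in> j ` sphere 0 R \<Longrightarrow> \<Phi> y = \<phi> (\<iota> y)"
    using Tietze_unbounded[of "j ` sphere 0 R" "\<lambda>y. \<phi> (\<iota> y)" UNIV] by (metis closed_closedin subtopology_UNIV)
  \<comment> \<open>Glues \<open>W\<close> in the inverted coordinate to the exponential of a Tietze
    extension of \<open>\<phi>\<close>. The two pieces meet only over the circle, where they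
    agree.\<close>
  define V where "V = (\<lambda>y. if y \<in> K then W (\<iota> y) else exp (\<Phi> y))"
  have K: "\<iota> y \<in> cball 0 R - D \<and> y \<noteq> 0" if y: "y \<in> K" for y
  proof -
    obtain z where "z \<in> cball 0 R - D" "y = j z" using y unfolding K_def by blast
    moreover then have "z \<noteq> a" using D by auto
    ultimately show ?thesis using \<iota>j by auto
  qed
  then have 0: "0 \<notin> K" by blast
  have "continuous_on (K \<union> B) V"
    unfolding V_def
  proof (rule continuous_on_cases)
    show "closed K" using \<open>compact K\<close> by (rule compact_imp_closed)
    show "closed B" by fact
    show "continuous_on K (\<lambda>y. W (\<iota> y))"
      by (rule continuous_on_compose2[OF W(1) cont_\<iota>[OF 0]]) (use K in blast)
    show "continuous_on B (\<lambda>y. exp (\<Phi> y))"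
      by (intro continuous_intros continuous_on_subset[OF \<Phi>(1)]) auto
    show "\<forall>y. y \<in> K \<and> y \<notin> K \<or> y \<in> B \<and> y \<in> K \<longrightarrow> W (\<iota> y) = exp (\<Phi> y)"
    proof (intro allI impI)
      fix y assume y: "y \<in> K \<and> y \<notin> K \<or> y \<in> B \<and> y \<in> K"
      then obtain z where z: "z \<in> cball 0 R - D" "y = j z" unfolding K_def by blast
      then have "z \<noteq> a" using D by auto
      then have "\<iota> y = z" "y \<noteq> 0" using z \<iota>j by auto
      then have "R \<le> cmod z" using y by (auto simp: B_def)
      then have "z \<in> sphere 0 R" using z by auto
      then show "W (\<iota> y) = exp (\<Phi> y)" using \<Phi>(2) \<phi>(2) z \<open>\<iota> y = z\<close> by auto
    qed
  qed
  moreover have "V y \<noteq> 0" if "y \<in> K \<union> B" for y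
    using W(2) K by (simp add: V_def)
  ultimately obtain g where g: "continuous_on (K \<union> B) g" "\<And>y. y \<in> K \<union> B \<Longrightarrow> V y = exp (g y)"
    using Bors unfolding Borsukian_continuous_logarithm by (metis ComplI Pi_I singletonD)
  show ?thesis
  proof (rule has_logI)
    show "continuous_on (cball 0 R - D) (\<lambda>z. g (j z))"
      by (rule continuous_on_compose2[OF g(1) cont_j]) (use D in \<open>auto simp: K_def\<close>)
    fix z assume z: "z \<in> cball 0 R - D"
    then have "j z \<in> K" "z \<noteq> a" using D by (auto simp: K_def)
    then show "W z = exp (g (j z))" using g(2)[of "j z"] \<iota>j by (simp add: V_def)
  qed
qed

section \<open>Regular closed level curves in the plane\<close>

context
  fixes h :: "'a::euclidean_space \<Rightarrow> real" and N :: "'a \<Rightarrow> 'a"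
  assumes deriv: "\<And>z. (h has_derivative (\<lambda>v. N z \<bullet> v)) (at z)"
    and contN: "continuous_on UNIV N"
begin

lemma has_gradient_imp_continuous_on: "continuous_on S h"
  by (rule has_derivative_continuous_on) (rule has_derivative_at_withinI[OF deriv])

lemma increasing_along_direction:
  assumes "0 < t" "\<And>s. 0 \<le> s \<Longrightarrow> s \<le> t \<Longrightarrow> N (z + s *\<^sub>R n) \<bullet> n > 0"
  shows "h z < h (z + t *\<^sub>R n)"
proof -
  have "\<exists>y. ((\<lambda>s. h (z + s *\<^sub>R n)) has_real_derivative y) (at s) \<and> 0 < y" if "0 \<le> s" "s \<le> t" for s
  proof (intro exI conjI)
    have "((\<lambda>s. h (z + s *\<^sub>R n)) has_derivative (\<lambda>x. N (z + s *\<^sub>R n) \<bullet> (x *\<^sub>R n))) (at s)"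
      by (rule has_derivative_compose[where f = "\<lambda>s. z + s *\<^sub>R n", OF _ deriv])
        (auto intro!: derivative_eq_intros)
    then show "((\<lambda>s. h (z + s *\<^sub>R n)) has_real_derivative N (z + s *\<^sub>R n) \<bullet> n) (at s)"
      unfolding has_field_derivative_def by (rule has_derivative_eq_rhs) (auto simp: fun_eq_iff)
  qed (use assms that in auto)
  from DERIV_pos_imp_increasing[OF assms(1), of "\<lambda>s. h (z + s *\<^sub>R n)", OF this]
  show ?thesis by simp
qed

lemma gradient_positive_near:
  assumes "N p \<noteq> 0"
  obtains r where "r > 0" "\<And>z. z \<in> ball p r \<Longrightarrow> N z \<bullet> N p > 0"
proof -
  have "open {z. N z \<bullet> N p > 0}"
    by (intro open_Collect_less continuous_intros contN)
  moreover have "p \<in> {z. N z \<bullet> N p > 0}" using assms by simp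
  ultimately obtain r where "r > 0" "ball p r \<subseteq> {z. N z \<bullet> N p > 0}"
    by (meson openE)
  then show ?thesis using that by blast
qed

text \<open>Near \<open>p\<close> the gradient keeps a positive component along \<open>N p\<close>,
  so short steps in that direction increase \<open>h\<close>.\<close>

lemma regular_zero_in_closure:
  assumes "h p = 0" "N p \<noteq> 0"
  shows "p \<in> closure {z. h z > 0}"
proof -
  obtain r where r: "r > 0" "\<And>z. z \<in> ball p r \<Longrightarrow> N z \<bullet> N p > 0"
    using gradient_positive_near assms(2) by blast
  show ?thesis
    unfolding closure_approachable
  proof (intro allI impI)
    fix e :: real assume e: "e > 0"
    define t where "t = min r e / (2 * norm (N p))"
    have t: "t > 0" "norm (t *\<^sub>R N p) < r" "norm (t *\<^sub>R N p) < e"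
      using r e assms by (auto simp: t_def)
    have "h p < h (p + t *\<^sub>R N p)"
    proof (rule increasing_along_direction[OF t(1)])
      fix s assume "0 \<le> s" "s \<le> t"
      then have "norm (s *\<^sub>R N p) \<le> norm (t *\<^sub>R N p)" by (simp add: mult_right_mono)
      then show "0 < N (p + s *\<^sub>R N p) \<bullet> N p" using t by (intro r(2)) (simp add: dist_norm)
    qed
    then show "\<exists>y\<in>{z. 0 < h z}. dist y p < e"
      using t assms by (intro bexI[of _ "p + t *\<^sub>R N p"]) (auto simp: dist_norm)
  qed
qed

text \<open>Every positive point near \<open>p\<close> climbs along a segment parallel to
  \<open>N p\<close> into one small ball on which \<open>h\<close> is positive; \<open>C\<close> is
  that ball together with these segments.\<close>

lemma superlevel_locally_connected:
  assumes "h p = 0" "N p \<noteq> 0"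
  obtains \<sigma> C where "\<sigma> > 0" "connected C" "C \<subseteq> {z. h z > 0}" "ball p \<sigma> \<inter> {z. h z > 0} \<subseteq> C"
proof -
  obtain r where r: "r > 0" "\<And>z. z \<in> ball p r \<Longrightarrow> N z \<bullet> N p > 0"
    using gradient_positive_near assms(2) by blast
  define n where "n = N p"
  \<comment> \<open>Segments of length \<open>r / 2\<close> starting in
    \<open>ball p (r / 2)\<close> stay in \<open>ball p r\<close>, where the gradient estimate
    holds.\<close>
  define t where "t = r / (2 * norm n)"
  have t: "t > 0" "norm (t *\<^sub>R n) = r / 2"
    using r assms by (auto simp: t_def n_def)
  have inc: "h z < h (z + u *\<^sub>R n)" if z: "dist p z < r / 2" "0 < u" "u \<le> t" for z u
  proof (rule increasing_along_direction[OF z(2)])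
    fix s assume "0 \<le> s" "s \<le> u"
    then have "norm (s *\<^sub>R n) \<le> norm (t *\<^sub>R n)" using z by (simp add: mult_right_mono)
    then have "dist p z + norm (s *\<^sub>R n) < r" using t z by simp
    then have "dist p (z + s *\<^sub>R n) < r"
      by (metis add_diff_cancel_left' dist_commute dist_norm dist_triangle_lt)
    then show "0 < N (z + s *\<^sub>R n) \<bullet> n" unfolding n_def by (intro r(2)) simp
  qed
  have "open {z. h z > 0}"
    by (intro open_Collect_less continuous_intros has_gradient_imp_continuous_on)
  moreover have "p + t *\<^sub>R n \<in> {z. h z > 0}"
    using inc[of p t] r t assms by auto
  ultimately obtain d where d: "d > 0" "ball (p + t *\<^sub>R n) d \<subseteq> {z. h z > 0}"
    by (meson openE)
  define \<sigma> where "\<sigma> = min d (r / 2)"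
  define Z where "Z = {z \<in> ball p \<sigma>. h z > 0}"
  define C where "C = \<Union> ((\<lambda>z. ball (p + t *\<^sub>R n) d \<union> closed_segment z (z + t *\<^sub>R n)) ` Z) \<union> ball (p + t *\<^sub>R n) d"
  show thesis
  proof
    show "\<sigma> > 0" using d r by (simp add: \<sigma>_def)
    show "connected C"
    proof (cases "Z = {}")
      case False
      have "connected (\<Union> ((\<lambda>z. ball (p + t *\<^sub>R n) d \<union> closed_segment z (z + t *\<^sub>R n)) ` Z))"
      proof (rule connected_Union)
        show "\<Inter> ((\<lambda>z. ball (p + t *\<^sub>R n) d \<union> closed_segment z (z + t *\<^sub>R n)) ` Z) \<noteq> {}"
          using d by (auto intro!: exI[of _ "p + t *\<^sub>R n"])
        show "connected S" if S: "S \<in> (\<lambda>z. ball (p + t *\<^sub>R n) d \<union> closed_segment z (z + t *\<^sub>R n)) ` Z" for S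
        proof -
          obtain z where z: "z \<in> Z" "S = ball (p + t *\<^sub>R n) d \<union> closed_segment z (z + t *\<^sub>R n)"
            using S by blast
          have "z + t *\<^sub>R n \<in> ball (p + t *\<^sub>R n) d \<inter> closed_segment z (z + t *\<^sub>R n)"
            using z by (auto simp: Z_def \<sigma>_def)
          then show ?thesis unfolding z(2) by (intro connected_Un connected_ball connected_segment) blast
        qed
      qed
      moreover have "C = \<Union> ((\<lambda>z. ball (p + t *\<^sub>R n) d \<union> closed_segment z (z + t *\<^sub>R n)) ` Z)"
        using False unfolding C_def by blast
      ultimately show ?thesis by simp
    qed (simp add: C_def)
    show "C \<subseteq> {z. h z > 0}"
    proof -
      have "h x > 0" if z: "z \<in> Z" and x: "x \<in> closed_segment z (z + t *\<^sub>R n)" for x z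
      proof -
        obtain u where u: "0 \<le> u" "u \<le> 1" "x = z + (u * t) *\<^sub>R n"
          using x by (auto simp: closed_segment_def algebra_simps)
        show ?thesis
        proof (cases "u = 0")
          case False
          then have "h z < h (z + (u * t) *\<^sub>R n)"
            using z u t by (intro inc) (auto simp: Z_def \<sigma>_def mult_left_le_one_le)
          then show ?thesis using u z by (simp add: Z_def)
        qed (use u z Z_def in auto)
      qed
      then show ?thesis using d unfolding C_def by blast
    qed
    show "ball p \<sigma> \<inter> {z. h z > 0} \<subseteq> C"
      by (auto simp: C_def Z_def)
  qed
qed

lemma frontier_superlevel_subset: "frontier {z. h z > 0} \<subseteq> {z. h z = 0}"
proof -
  have "open {z. h z > 0}" "closed {z. h z \<ge> 0}"
    by (intro open_Collect_less closed_Collect_le continuous_intros has_gradient_imp_continuous_on)+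
  moreover from this(2) have "closure {z. h z > 0} \<subseteq> {z. h z \<ge> 0}"
    by (intro closure_minimal) auto
  ultimately show ?thesis
    unfolding frontier_def by (fastforce simp: interior_open)
qed

text \<open>The closure of any component of the positive set meets the zero set in a nonempty clopen
  part, hence in all of it. So all components accumulate at one common point, where local
  connectedness identifies them.\<close>

lemma connected_superlevel:
  assumes conn: "connected {z. h z = 0}" and ne: "{z. h z = 0} \<noteq> {}"
    and N: "\<And>z. h z = 0 \<Longrightarrow> N z \<noteq> 0"
  shows "connected {z. h z > 0}"
proof -
  define D S where "D = {z. h z > 0}" and "S = {z. h z = 0}"
  have opD: "open D"
    unfolding D_def by (intro open_Collect_less continuous_intros has_gradient_imp_continuous_on)
  have DS: "frontier D \<subseteq> S" "D \<inter> S = {}" "S \<subseteq> closure D"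
    using frontier_superlevel_subset regular_zero_in_closure N by (auto simp: D_def S_def)
  have loc: "\<exists>\<sigma> C. \<sigma> > 0 \<and> connected C \<and> C \<subseteq> D \<and> ball p \<sigma> \<inter> D \<subseteq> C" if "p \<in> S" for p
    using superlevel_locally_connected[of p] N that unfolding S_def D_def by (metis mem_Collect_eq)
  have all: "S \<subseteq> closure (connected_component_set D x)" if x: "x \<in> D" for x
  proof -
    define E where "E = connected_component_set D x"
    have E: "x \<in> E" "E \<subseteq> D" "frontier E \<subseteq> frontier D"
      unfolding E_def using x connected_component_subset
      by (simp, blast, intro Path_Connected.frontier_of_connected_component_subset)
    \<comment> \<open>\<open>E\<close> misses the nonempty zero set, so it is not the whole space
      and has a frontier point, which lies on the zero set.\<close>
    obtain s where "s \<in> S" using ne S_def by blast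
    then have "E \<noteq> UNIV" using E DS by blast
    then have "frontier E \<noteq> {}" using E frontier_eq_empty[of E] by (metis empty_iff)
    then obtain p where "p \<in> frontier E" by blast
    then have "p \<in> S \<inter> closure E"
      using E(3) DS(1) by (simp add: frontier_def[of E] subset_iff)
    then have "S \<inter> closure E \<noteq> {}" by blast
    moreover have "closedin (top_of_set S) (S \<inter> closure E)" by (simp add: closedin_closed_Int)
    moreover have "openin (top_of_set S) (S \<inter> closure E)"
      unfolding openin_contains_ball
    proof (intro conjI ballI)
      fix p assume p: "p \<in> S \<inter> closure E"
      then obtain \<sigma> C where C: "\<sigma> > 0" "connected C" "C \<subseteq> D" "ball p \<sigma> \<inter> D \<subseteq> C"
        using loc by blast
      obtain y where y: "y \<in> E" "dist y p < \<sigma>"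
        using p C(1) by (meson IntD2 closure_approachable)
      then have "y \<in> C" using C(4) E(2) by (auto simp: dist_commute)
      then have CC: "C \<subseteq> E"
        using connected_component_maximal[OF _ C(2,3)] connected_component_eq y(1) unfolding E_def by metis
      have "ball p \<sigma> \<inter> S \<subseteq> closure (ball p \<sigma> \<inter> D)"
        using open_Int_closure_subset[of "ball p \<sigma>" D] DS(3) by auto
      also have "\<dots> \<subseteq> closure E" using C(4) CC by (intro closure_mono) blast
      finally have "ball p \<sigma> \<inter> S \<subseteq> S \<inter> closure E" by blast
      then show "\<exists>e>0. ball p e \<inter> S \<subseteq> S \<inter> closure E" using C(1) by blast
    qed blast
    ultimately have "S \<inter> closure E = S" using conn unfolding connected_clopen S_def by blast
    then show ?thesis unfolding E_def by blast
  qed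
  obtain p where p: "p \<in> S" using ne S_def by blast
  then obtain \<sigma> C where C: "\<sigma> > 0" "connected C" "C \<subseteq> D" "ball p \<sigma> \<inter> D \<subseteq> C"
    using loc by blast
  have meet: "\<exists>u. connected_component D x u \<and> u \<in> C" if x: "x \<in> D" for x
  proof -
    have "p \<in> closure (connected_component_set D x)" using all[OF x] p by blast
    then obtain u where "u \<in> connected_component_set D x" "dist u p < \<sigma>"
      using C(1) by (meson closure_approachable)
    moreover then have "u \<in> D" using connected_component_subset by fast
    ultimately show ?thesis using C(4) by (auto simp: dist_commute)
  qed
  have "connected_component D x y" if xy: "x \<in> D" "y \<in> D" for x y
  proof -
    obtain u v where "connected_component D x u" "u \<in> C" "connected_component D y v" "v \<in> C"
      using meet xy by blast
    moreover then have "connected_component D u v" using C unfolding connected_component_def by blast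
    ultimately show ?thesis
      by (meson connected_component_sym connected_component_trans)
  qed
  then show ?thesis using connected_iff_connected_component unfolding D_def by blast
qed

end

text \<open>A logarithm of \<open>z - a\<close> would lift the normalised map to the circle to a
  real angle and make it inessential; Borsuk's theorem forbids this when \<open>a\<close> lies in a
  bounded component.\<close>

lemma not_has_log_around_component:
  fixes S :: "complex set"
  assumes "compact S" "a \<notin> S" "bounded (connected_component_set (- S) a)"
  shows "\<not> has_log S (\<lambda>z. z - a)"
proof
  assume "has_log S (\<lambda>z. z - a)"
  then obtain \<phi> where \<phi>: "continuous_on S \<phi>" "\<And>z. z \<in> S \<Longrightarrow> z - a = exp (\<phi> z)"
    by (metis has_logE)
  have "inverse (norm (z - a)) *\<^sub>R (z - a) = exp (\<i> * of_real (Im (\<phi> z)))" if "z \<in> S" for z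
  proof -
    have "z - a = exp (Re (\<phi> z)) *\<^sub>R exp (\<i> * of_real (Im (\<phi> z)))"
      using \<phi>(2)[OF that] exp_eq_polar[of "\<phi> z"] by (simp add: scaleR_conv_of_real cis_conv_exp)
    moreover then have "norm (z - a) = exp (Re (\<phi> z))" by simp
    ultimately show ?thesis by simp
  qed
  then have "\<exists>g. continuous_on S g \<and>
      (\<forall>z\<in>S. inverse (norm (z - a)) *\<^sub>R (z - a) = exp (\<i> * of_real (g z)))"
    by (intro exI[of _ "\<lambda>z. Im (\<phi> z)"] conjI continuous_intros \<phi>) auto
  then show False
    using Borsuk_map_essential_bounded_component[OF assms(1,2)] assms(3)
    unfolding inessential_eq_continuous_logarithm_circle[symmetric] by blast
qed

section \<open>Winding numbers along an oval\<close>

locale plane_oval =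
  fixes h :: "complex \<Rightarrow> real" and N :: "complex \<Rightarrow> complex" and R :: real
  assumes deriv: "\<And>z. (h has_derivative (\<lambda>v. N z \<bullet> v)) (at z)"
    and contN: "continuous_on UNIV N"
    and connected_oval: "connected {z. h z = 0}"
    and nonempty_oval: "{z. h z = 0} \<noteq> {}"
    and regular: "\<And>z. h z = 0 \<Longrightarrow> N z \<noteq> 0"
    and outside: "\<And>z. R \<le> cmod z \<Longrightarrow> h z < 0"
begin

abbreviation oval :: "complex set" where "oval \<equiv> {z. h z = 0}"
abbreviation interior_region :: "complex set" where "interior_region \<equiv> {z. h z > 0}"

lemma cont_h: "continuous_on S h"
  by (rule has_gradient_imp_continuous_on[OF deriv contN])

lemma region_subset: "interior_region \<subseteq> ball 0 R" and oval_subset: "oval \<subseteq> ball 0 R"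
  using outside by (fastforce simp: not_less[symmetric])+

lemma open_region: "open interior_region"
  by (intro open_Collect_less continuous_intros cont_h)

lemma compact_oval: "compact oval"
proof -
  have "closed oval" by (intro closed_Collect_eq continuous_intros cont_h)
  then show ?thesis
    using oval_subset bounded_ball bounded_subset compact_eq_bounded_closed by blast
qed

lemma connected_region: "connected interior_region"
  using connected_superlevel[OF deriv contN connected_oval nonempty_oval regular] .

text \<open>The superlevel result applies to \<open>-h\<close>, which has the same regular zeros;
  the oval adds only limit points of the negative set.\<close>

lemma connected_complement: "connected (- interior_region)"
proof -
  have deriv': "((\<lambda>z. - h z) has_derivative (\<lambda>v. - N z \<bullet> v)) (at z)" for z
    using has_derivative_minus[OF deriv[of z]] by simp
  have contN': "continuous_on UNIV (\<lambda>z. - N z)" by (intro continuous_intros contN)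
  have conn: "connected {z. - h z > 0}"
    by (rule connected_superlevel[OF deriv' contN']) (use connected_oval nonempty_oval regular in auto)
  have "oval \<subseteq> closure {z. - h z > 0}"
    using regular_zero_in_closure[OF deriv' contN'] regular by auto
  moreover have "- interior_region = oval \<union> {z. - h z > 0}" by auto
  ultimately have "- interior_region \<subseteq> closure {z. - h z > 0}"
    using closure_subset[of "{z. - h z > 0}"] by simp
  then show ?thesis
    by (intro connected_intermediate_closure[OF conn]) auto
qed

lemma contractible_region: "contractible interior_region"
  using open_region connected_region connected_complement region_subset bounded_subset[OF bounded_ball]
  by (metis contractible_eq_simply_connected_2d simply_connected_iff_simple)

text \<open>A connected set avoiding the oval cannot cross the frontier of the region, so the
  component of \<open>a\<close> stays inside.\<close>

lemma component_bounded:
  assumes "a \<in> interior_region"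
  shows "bounded (connected_component_set (- oval) a)"
proof -
  define C where "C = connected_component_set (- oval) a"
  have C: "connected C" "C \<subseteq> - oval" "a \<in> C"
    using assms by (simp_all add: C_def connected_component_subset)
  have "C \<inter> frontier interior_region = {}"
    using frontier_superlevel_subset[OF deriv contN] C(2) by (meson disjoint_iff subset_iff ComplD)
  moreover have "C \<inter> interior_region \<noteq> {}" using assms C(3) by (meson disjoint_iff)
  ultimately have "C - interior_region = {}"
    using connected_Int_frontier[OF C(1)] by metis
  then have "C \<subseteq> ball 0 R" using region_subset by (meson Diff_eq_empty_iff subset_trans)
  then show ?thesis
    unfolding C_def by (rule bounded_subset[OF bounded_ball])
qed

lemma push_inwards:
  obtains \<epsilon> where "\<epsilon> > 0" "\<And>z. z \<in> oval \<Longrightarrow> h (z + \<epsilon> *\<^sub>R N z) > 0"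
proof -
  have "continuous_on oval (\<lambda>z. norm (N z))" by (intro continuous_intros continuous_on_subset[OF contN]) auto
  then obtain M m where M: "M \<in> oval" "\<And>z. z \<in> oval \<Longrightarrow> norm (N z) \<le> norm (N M)"
    and m: "m \<in> oval" "\<And>z. z \<in> oval \<Longrightarrow> norm (N m) \<le> norm (N z)"
    using continuous_attains_sup[OF compact_oval nonempty_oval] continuous_attains_inf[OF compact_oval nonempty_oval]
    by metis
  have pos: "norm (N m) > 0" "norm (N M) > 0" using M m regular by auto
  have "uniformly_continuous_on (cball 0 (R + 1)) N"
    by (intro compact_uniformly_continuous continuous_on_subset[OF contN]) auto
  then obtain d where d: "d > 0" "\<And>x y. x \<in> cball 0 (R+1) \<Longrightarrow> y \<in> cball 0 (R+1) \<Longrightarrow> dist y x < d \<Longrightarrow> dist (N y) (N x) < norm (N m)"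
    unfolding uniformly_continuous_on_def using pos by metis
  \<comment> \<open>Displacements are then below 1, which keeps points in
    \<open>cball 0 (R + 1)\<close>, and below \<open>d\<close>, so that \<open>N\<close> changes by
    less than its minimal length on the oval.\<close>
  define \<epsilon> where "\<epsilon> = min 1 d / (2 * norm (N M))"
  have \<epsilon>: "\<epsilon> > 0" "\<epsilon> * norm (N M) < d" "\<epsilon> * norm (N M) < 1"
    using pos d by (auto simp: \<epsilon>_def)
  show thesis
  proof
    show "\<epsilon> > 0" by fact
    fix z assume z: "z \<in> oval"
    have "h z < h (z + \<epsilon> *\<^sub>R N z)"
    proof (rule increasing_along_direction[OF deriv contN \<epsilon>(1)])
      fix s assume s: "0 \<le> s" "s \<le> \<epsilon>"
      let ?z = "z + s *\<^sub>R N z"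
      have "norm (s *\<^sub>R N z) \<le> \<epsilon> * norm (N M)" using s M(2)[OF z] by (simp add: mult_mono)
      then have *: "dist ?z z < d" "norm (s *\<^sub>R N z) \<le> 1" using \<epsilon> by (auto simp: dist_norm)
      have "norm z < R" using z oval_subset by auto
      then have "z \<in> cball 0 (R + 1)" "?z \<in> cball 0 (R + 1)"
        using *(2) norm_triangle_ineq[of z "s *\<^sub>R N z"] by auto
      then have "dist (N ?z) (N z) < norm (N z)" using d(2) * m(2)[OF z] by fastforce
      then have "\<bar>(N ?z - N z) \<bullet> N z\<bar> < norm (N z) * norm (N z)"
        using Cauchy_Schwarz_ineq2[of "N ?z - N z" "N z"] regular z
        by (smt (verit) dist_norm mem_Collect_eq mult_strict_right_mono zero_less_norm_iff)
      then show "0 < N ?z \<bullet> N z"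
        by (simp add: inner_diff_left dot_square_norm power2_eq_square)
    qed
    then show "h (z + \<epsilon> *\<^sub>R N z) > 0" using z by simp
  qed
qed

text \<open>Pushing the curve inwards along the gradient and contracting it within the region compares
  the gradient with the vector field of differences \<open>z - a\<close>; this replaces the
  theorem on the rotation of the tangent of a simple closed curve.\<close>

lemma gradient_log:
  obtains a where "a \<in> interior_region" "has_log oval (\<lambda>z. N z / (z - a))"
proof -
  obtain \<epsilon> where \<epsilon>: "\<epsilon> > 0" "\<And>z. z \<in> oval \<Longrightarrow> h (z + \<epsilon> *\<^sub>R N z) > 0"
    using push_inwards by blast
  define f where "f z = z + \<epsilon> *\<^sub>R N z" for z
  have contf: "continuous_on oval f"
    unfolding f_def by (intro continuous_intros continuous_on_subset[OF contN]) auto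
  have "f \<in> oval \<rightarrow> interior_region" using \<epsilon> by (auto simp: f_def)
  from nullhomotopic_into_contractible[OF contf this contractible_region]
  obtain a where "homotopic_with_canon (\<lambda>h. True) oval interior_region f (\<lambda>x. a)" .
  then obtain H where H: "continuous_on ({0..1::real} \<times> oval) H" "H \<in> {0..1} \<times> oval \<rightarrow> interior_region"
      "\<And>z. z \<in> oval \<Longrightarrow> H (0, z) = f z" "\<And>z. z \<in> oval \<Longrightarrow> H (1, z) = a"
    unfolding homotopic_with_def by (auto simp: Pi_iff)
  obtain z where "z \<in> oval" using nonempty_oval by blast
  then have a: "a \<in> interior_region" using H(2) H(4)[of z] by force
  \<comment> \<open>\<open>z\<close> is on the oval and \<open>H\<close> in the open region, so the
    difference never vanishes; it deforms a negative multiple of \<open>N z\<close> into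
    \<open>z - a\<close>.\<close>
  have "has_log oval (\<lambda>z. (\<lambda>p. snd p - H p) (1, z) / (\<lambda>p. snd p - H p) (0, z))"
  proof (rule has_log_homotopy)
    show "continuous_on ({0..1} \<times> oval) (\<lambda>p. snd p - H p)" by (intro continuous_intros H)
    show "snd (t, z) - H (t, z) \<noteq> 0" if t: "t \<in> {0..1}" and z: "z \<in> oval" for t z
    proof -
      have "h (H (t, z)) > 0" using H(2) t z by blast
      then show ?thesis using z by auto
    qed
  qed
  then have "has_log oval (\<lambda>z. (z - a) / (- of_real \<epsilon> * N z))"
    by (rule has_log_cong) (use H in \<open>auto simp: f_def scaleR_conv_of_real\<close>)
  from has_log_divide[OF has_log_const[of 1] this]
  have "has_log oval (\<lambda>z. 1 / ((z - a) / (- of_real \<epsilon> * N z)))" by simp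
  from has_log_mult[OF this has_log_const[of "- 1 / of_real \<epsilon>"]]
  have "has_log oval (\<lambda>z. N z / (z - a))"
    by (rule has_log_cong) (use \<epsilon> in auto)
  with a show thesis by (rule that)
qed

text \<open>By the assumption at infinity \<open>w\<close> has winding number \<open>-k\<close>,
  also along the oval. As \<open>N\<close> has winding number 1 and \<open>\<tau>\<close> has 0, the
  quotient \<open>\<psi>\<close> has \<open>-(k + 2)\<close>, and its root of order
  \<open>k + 2\<close> has \<open>-1\<close>. This root meets every ray, and different roots of
  unity give different points.\<close>

theorem two_tangency_points:
  fixes w :: "complex \<Rightarrow> complex" and \<tau> :: "complex \<Rightarrow> real"
  assumes w: "continuous_on UNIV w" "\<And>z. h z \<le> 0 \<Longrightarrow> w z \<noteq> 0"
    and \<tau>: "continuous_on UNIV \<tau>" "\<And>z. h z = 0 \<Longrightarrow> \<tau> z \<noteq> 0"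
    and infinity: "has_log (sphere 0 R) (\<lambda>z. w z * z ^ k)"
  obtains p q where "p \<noteq> q" "h p = 0" "h q = 0"
    "\<exists>r>0. w p = of_real (r * \<tau> p) * (N p)\<^sup>2" "\<exists>r>0. w q = of_real (r * \<tau> q) * (N q)\<^sup>2"
proof -
  obtain a where a: "a \<in> interior_region" and Na: "has_log oval (\<lambda>z. N z / (z - a))"
    by (rule gradient_log)
  have aR: "cmod a < R" using a region_subset by auto
  \<comment> \<open>\<open>1 - a / z\<close> has positive real part on the circle. This moves the
    zero of the power from 0 to \<open>a\<close>, which is known to lie inside the region.\<close>
  have "has_log (sphere 0 R) (\<lambda>z. (z - a) / z)"
  proof (rule has_log_avoiding_nonpos_Reals)
    show "continuous_on (sphere 0 R) (\<lambda>z. (z - a) / z)" using aR by (intro continuous_intros) auto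
    fix z :: complex assume "z \<in> sphere 0 R"
    then have "cmod (a / z) < 1" "z \<noteq> 0" using aR by (auto simp: norm_divide divide_less_eq)
    moreover then have "(z - a) / z = 1 - a / z" by (simp add: field_simps)
    moreover have "Re (a / z) < 1" using \<open>cmod (a / z) < 1\<close> complex_Re_le_cmod[of "a/z"] by linarith
    ultimately show "(z - a) / z \<notin> \<real>\<^sub>\<le>\<^sub>0" by (auto simp: complex_nonpos_Reals_iff)
  qed
  from has_log_mult[OF infinity has_log_power[OF this, of k]]
  have "has_log (sphere 0 R) (\<lambda>z. w z * (z - a) ^ k)"
    by (rule has_log_cong) (use aR in \<open>auto simp: power_divide\<close>)
  \<comment> \<open>Neither \<open>w\<close> nor \<open>z - a\<close> vanishes outside the region,
    so the logarithm passes from the circle to the oval.\<close>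
  then have "has_log (cball 0 R - interior_region) (\<lambda>z. w z * (z - a) ^ k)"
    by (intro has_log_transport_inwards[OF open_region connected_region a region_subset]
        continuous_intros continuous_on_subset[OF w(1)])
      (use w(2) a in \<open>auto simp: not_less\<close>)
  then have wk: "has_log oval (\<lambda>z. w z * (z - a) ^ k)"
    by (rule has_log_subset) (use oval_subset in auto)
  have \<tau>log: "has_log oval (\<lambda>z. of_real (\<tau> z))"
    by (intro has_log_of_real connected_oval continuous_on_subset[OF \<tau>(1)]) (use \<tau>(2) in auto)
  define \<psi> where "\<psi> z = w z / (of_real (\<tau> z) * (N z)\<^sup>2)" for z
  have za: "z - a \<noteq> 0" "N z \<noteq> 0" if "z \<in> oval" for z using that a regular by auto
  from has_log_divide[OF has_log_divide[OF wk \<tau>log] has_log_power[OF Na, of 2]]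
  \<comment> \<open>The division by the square of \<open>N z / (z - a)\<close> supplies the two
    extra powers of \<open>z - a\<close>.\<close>
  have "has_log oval (\<lambda>z. \<psi> z * (z - a) ^ (k + 2))"
  proof (rule has_log_cong)
    have "w * d ^ k / t / (n / d)\<^sup>2 = w / (t * n\<^sup>2) * d ^ (k + 2)" for w d t n :: complex
      by (simp add: power_divide power_add del: add_2_eq_Suc')
    then show "\<psi> z * (z - a) ^ (k + 2) = w z * (z - a) ^ k / of_real (\<tau> z) / (N z / (z - a))\<^sup>2" for z
      unfolding \<psi>_def by metis
  qed
  then obtain \<phi> where \<phi>: "continuous_on oval \<phi>" "\<And>z. z \<in> oval \<Longrightarrow> \<psi> z * (z - a) ^ (k + 2) = exp (\<phi> z)"
    unfolding has_log_def by blast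
  define j where "j = k + 2"
  have j0: "j \<noteq> 0" unfolding j_def by simp
  \<comment> \<open>a \<open>j\<close>-th root of \<open>\<psi>\<close>; it meets the rays through two different \<open>j\<close>-th roots of unity\<close>
  define \<rho> where "\<rho> z = exp (\<phi> z / of_nat j) / (z - a)" for z
  have \<rho>: "\<rho> z ^ j = \<psi> z" if "z \<in> oval" for z
  proof -
    have "exp (\<phi> z / of_nat j) ^ j = exp (\<phi> z)"
      using exp_of_nat_mult[of j "\<phi> z / of_nat j"] by (simp add: j_def del: of_nat_add of_nat_Suc)
    also have "\<dots> = \<psi> z * (z - a) ^ j" using \<phi>(2)[OF that] by (simp only: j_def)
    finally show ?thesis using za(1)[OF that] by (simp add: \<rho>_def power_divide)
  qed
  \<comment> \<open>A logarithm of \<open>\<rho>\<close> would give one of \<open>z - a\<close>,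
    which winds around the region.\<close>
  have "\<not> has_log oval \<rho>"
  proof
    assume "has_log oval \<rho>"
    moreover have "has_log oval (\<lambda>z. exp (\<phi> z / of_nat j))"
      by (rule has_logI[of _ "\<lambda>z. \<phi> z / of_nat j"]) (auto intro!: continuous_intros \<phi> simp: j0)
    ultimately have "has_log oval (\<lambda>z. exp (\<phi> z / of_nat j) / \<rho> z)" by (intro has_log_divide)
    then have "has_log oval (\<lambda>z. z - a)"
      by (rule has_log_cong) (use za in \<open>auto simp: \<rho>_def\<close>)
    then show False
      using not_has_log_around_component[OF compact_oval _ component_bounded[OF a]] a by auto
  qed
  moreover have "continuous_on oval \<rho>"
    unfolding \<rho>_def using za by (intro continuous_intros \<phi>) (auto simp: j0)
  ultimately have hit: "\<exists>z r. z \<in> oval \<and> 0 \<le> r \<and> \<rho> z = of_real r * c" if "c \<noteq> 0" for c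
    using has_log_misses_ray that by blast
  \<comment> \<open>As \<open>c ^ j = 1\<close>, the value of \<open>\<psi>\<close> is the real
    number \<open>s ^ j\<close>; it is positive because \<open>w\<close> has no zero on the
    oval.\<close>
  have tangency: "\<exists>r>0. w z = of_real (r * \<tau> z) * (N z)\<^sup>2"
    if z: "z \<in> oval" and "0 \<le> s" "\<rho> z = of_real s * c" "c ^ j = 1" for z s c
  proof -
    have "\<psi> z = of_real (s ^ j)" using \<rho>[OF z] that by (simp add: power_mult_distrib)
    then have eq: "w z = of_real (s ^ j * \<tau> z) * (N z)\<^sup>2"
      using za[OF z] \<tau>(2)[of z] z by (simp add: \<psi>_def field_simps)
    have "h z \<le> 0" using z by simp
    then have "s ^ j \<noteq> 0" using w(2)[of z] eq by (metis mult_zero_left of_real_0)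
    then have "s ^ j > 0" using zero_le_power[OF \<open>0 \<le> s\<close>, of j] by linarith
    then show ?thesis using eq by blast
  qed
  \<comment> \<open>\<open>j\<close> is at least 2, so this root of unity is not 1.\<close>
  define c where "c = cis (2 * pi / real j)"
  have c: "c ^ j = 1" "c \<noteq> 0" "c \<noteq> 1"
  proof -
    have "c ^ j = cis (real j * (2 * pi / real j))" unfolding c_def by (rule Complex.DeMoivre)
    then show "c ^ j = 1" using j0 by (simp add: complex_eq_iff)
    show "c \<noteq> 0" by (simp add: c_def)
    show "c \<noteq> 1"
    proof
      assume "c = 1"
      then have "cos (2 * pi / real j) = 1" by (simp add: c_def complex_eq_iff)
      moreover have "0 < 2 * pi / real j" "2 * pi / real j \<le> pi" by (auto simp: j_def field_simps)
      then have "cos (2 * pi / real j) < 1" using cos_monotone_0_pi[of 0 "2 * pi / real j"] by simp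
      ultimately show False by simp
    qed
  qed
  obtain p r where p: "p \<in> oval" "0 \<le> r" "\<rho> p = of_real r * 1" using hit[of 1] by auto
  obtain q s where q: "q \<in> oval" "0 \<le> s" "\<rho> q = of_real s * c" using hit[of c] c by auto
  have "p \<noteq> q"
  proof
    assume "p = q"
    then have eq: "of_real r = of_real s * c" using p q by simp
    then have "cmod (of_real r) = cmod (of_real s * c)" by simp
    then have "r = s" using p q by (simp add: norm_mult c_def)
    moreover have "\<rho> p \<noteq> 0" using za(1)[OF p(1)] by (simp add: \<rho>_def)
    then have "r \<noteq> 0" using p(3) by auto
    ultimately show False using eq c(3) by simp
  qed
  then show thesis using that tangency[OF p(1,2,3)] tangency[OF q] c p q by auto
qed

end

section \<open>Polynomials in two variables\<close>

lemma eval2_simps [simp]: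
  "eval2 (f + g) q = eval2 f q + eval2 g q"
  "eval2 (f - g) q = eval2 f q - eval2 g q"
  "eval2 (f * g) q = eval2 f q * eval2 g q"
  "eval2 (f ^ k) q = eval2 f q ^ k"
  "eval2 0 q = 0"
  "eval2 (pCons a f) q = poly a (fst q) + snd q * eval2 f q"
  by (simp_all add: eval2_def)

lemma eval2_sum [simp]: "eval2 (sum f A) q = (\<Sum>i\<in>A. eval2 (f i) q)"
  by (induction A rule: infinite_finite_induct) auto

lemma eval2_monom [simp]: "eval2 (monom (monom c i) j) (x, y) = c * x ^ i * y ^ j"
  by (simp add: eval2_def poly_monom mult_ac poly_const_pow)

lemma coeff_dx: "coeff (coeff (dx f) j) i = real (Suc i) * coeff (coeff f j) (Suc i)"
  by (simp add: dx_def coeff_map_poly coeff_pderiv)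

lemma coeff_dy: "coeff (coeff (dy f) j) i = real (Suc j) * coeff (coeff f (Suc j)) i"
proof -
  have "of_nat (Suc j) = [:real (Suc j):]" by (simp only: of_nat_poly)
  then show ?thesis by (simp add: dy_def coeff_pderiv del: of_nat_Suc)
qed

lemma coeff_hom_part: "coeff (coeff (hom_part k f) j) i = (if i + j = k then coeff (coeff f j) i else 0)"
proof -
  have "coeff (coeff (hom_part k f) j) i
      = (\<Sum>l\<le>k. if l = j then (if i + j = k then coeff (coeff f j) i else 0) else 0)"
    unfolding hom_part_def coeff_sum by (intro sum.cong) auto
  then show ?thesis by (auto simp: sum.delta)
qed

lemma bipoly_eqI: "(\<And>i j. coeff (coeff f j) i = coeff (coeff g j) i) \<Longrightarrow> f = (g :: bipoly)"
  by (simp add: poly_eq_iff)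

lemma dx_hom_part: "dx (hom_part (Suc k) f) = hom_part k (dx f)"
  and dy_hom_part: "dy (hom_part (Suc k) f) = hom_part k (dy f)"
  by (rule bipoly_eqI, simp add: coeff_dx coeff_dy coeff_hom_part)+

lemma dx_dy_commute: "dx (dy f) = dy (dx f)"
  by (rule bipoly_eqI) (simp add: coeff_dx coeff_dy)

lemma dx_add [simp]: "dx (f + g) = dx f + dx g" and dy_add [simp]: "dy (f + g) = dy f + dy g"
  by (rule bipoly_eqI, simp add: coeff_dx coeff_dy algebra_simps)+

lemma dx_0 [simp]: "dx 0 = 0" and dy_0 [simp]: "dy 0 = 0"
  by (rule bipoly_eqI, simp add: coeff_dx coeff_dy)+

lemma dx_sum: "dx (sum f A) = (\<Sum>i\<in>A. dx (f i))" and dy_sum: "dy (sum f A) = (\<Sum>i\<in>A. dy (f i))"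
  by (induction A rule: infinite_finite_induct) auto

lemma dx_monom: "dx (monom (monom c i) j) = monom (monom (real i * c) (i - 1)) j"
  and dy_monom: "dy (monom (monom c i) j) = monom (monom (real j * c) i) (j - 1)"
  by (rule bipoly_eqI, auto simp: coeff_dx coeff_dy)+

lemma eval2_hom_part: "eval2 (hom_part k f) (x, y) = (\<Sum>j\<le>k. coeff (coeff f j) (k - j) * x ^ (k - j) * y ^ j)"
  by (simp add: hom_part_def)

lemma eval2_hom_part_scale: "eval2 (hom_part k f) (c *\<^sub>R z) = c ^ k * eval2 (hom_part k f) z"
proof -
  obtain x y where z: "z = (x, y)" by (cases z)
  have "(c * x) ^ (k - j) * (c * y) ^ j = c ^ k * (x ^ (k - j) * y ^ j)" if "j \<le> k" for j
  proof -
    have "c ^ k = c ^ (k - j) * c ^ j" using that by (simp flip: power_add)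
    then show ?thesis by (simp add: power_mult_distrib)
  qed
  then show ?thesis
    by (auto simp: z eval2_hom_part sum_distrib_left mult.assoc intro!: sum.cong)
qed

lemma euler_hom_part:
  "fst z * eval2 (dx (hom_part k f)) z + snd z * eval2 (dy (hom_part k f)) z = real k * eval2 (hom_part k f) z"
proof -
  obtain x y where z: "z = (x, y)" by (cases z)
  \<comment> \<open>For \<open>i = 0\<close> the truncated exponent \<open>i - 1\<close> is 0, but
    the factor \<open>real i\<close> vanishes.\<close>
  have p: "x * (real i * x ^ (i - 1)) = real i * x ^ i" for x :: real and i :: nat
    by (cases i) auto
  have "x * (real (k - j) * c * x ^ (k - j - 1) * y ^ j) + y * (real j * c * x ^ (k - j) * y ^ (j - 1))
      = real k * (c * x ^ (k - j) * y ^ j)" if "j \<le> k" for j c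
  proof -
    have "x * (real (k - j) * c * x ^ (k - j - 1) * y ^ j) + y * (real j * c * x ^ (k - j) * y ^ (j - 1))
      = c * y ^ j * (x * (real (k - j) * x ^ (k - j - 1))) + c * x ^ (k - j) * (y * (real j * y ^ (j - 1)))"
      by (simp add: mult_ac)
    also have "\<dots> = real k * (c * x ^ (k - j) * y ^ j)"
      unfolding p using that by (simp add: of_nat_diff algebra_simps)
    finally show ?thesis .
  qed
  then show ?thesis
    by (auto simp: z hom_part_def dx_sum dy_sum dx_monom dy_monom sum_distrib_left
        simp flip: sum.distrib intro!: sum.cong)
qed

lemma eval2_has_derivative [derivative_intros]:
  "(eval2 f has_derivative (\<lambda>v. eval2 (dx f) q * fst v + eval2 (dy f) q * snd v)) (at q within S)"
proof (induction f)
  case 0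
  have "eval2 0 = (\<lambda>_. 0)" by (simp add: fun_eq_iff)
  then show ?case by simp
next
  case (pCons a p)
  have dxp: "dx (pCons a p) = pCons (pderiv a) (dx p)"
    by (rule bipoly_eqI) (auto simp: coeff_dx coeff_pCons coeff_pderiv split: nat.splits)
  have dyp: "dy (pCons a p) = p + pCons 0 (dy p)"
    by (simp add: dy_def pderiv_pCons)
  have e: "eval2 (pCons a p) = (\<lambda>q. poly a (fst q) + snd q * eval2 p q)"
    by (simp add: fun_eq_iff)
  have "((\<lambda>q. poly a (fst q)) has_derivative (\<lambda>v. poly (pderiv a) (fst q) * fst v)) (at q within S)"
    by (rule has_derivative_compose[OF has_derivative_fst[OF has_derivative_ident]])
      (use poly_DERIV[of a "fst q"] in \<open>simp add: has_field_derivative_def\<close>)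
  then show ?case
    unfolding e dxp dyp
    by (rule has_derivative_eq_rhs[OF has_derivative_add[OF _ has_derivative_mult[OF has_derivative_snd[OF has_derivative_ident] pCons(2)]]])
      (auto simp: fun_eq_iff algebra_simps)
qed

lemma continuous_on_eval2 [continuous_intros]:
  "continuous_on S g \<Longrightarrow> continuous_on S (\<lambda>x. eval2 f (g x))"
  by (rule continuous_on_compose2[of UNIV "eval2 f"])
    (auto intro!: has_derivative_continuous_on eval2_has_derivative)

section \<open>Total degree and expansion at infinity\<close>

lemma coeff_eq_0_above_total_degree:
  assumes "coeff (coeff f j) i \<noteq> 0"
  shows "i + j \<le> total_degree f"
proof -
  let ?A = "{i + j | i j. coeff (coeff f j) i \<noteq> 0}"
  let ?B = "{(i, j). coeff (coeff f j) i \<noteq> 0}"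
  \<comment> \<open>Finiteness of the support makes the supremum in \<open>total_degree\<close> an
    upper bound.\<close>
  have "?B \<subseteq> (\<Union>j\<in>{..degree f}. (\<lambda>i. (i, j)) ` {..degree (coeff f j)})"
  proof (intro subsetI)
    fix p assume "p \<in> ?B"
    then obtain i j where p: "p = (i, j)" "coeff (coeff f j) i \<noteq> 0" by blast
    then have "coeff f j \<noteq> 0" by auto
    then have "j \<le> degree f" "i \<le> degree (coeff f j)" using p by (auto intro: le_degree)
    then show "p \<in> (\<Union>j\<in>{..degree f}. (\<lambda>i. (i, j)) ` {..degree (coeff f j)})"
      using p by blast
  qed
  then have "finite ?B" by (rule finite_subset) auto
  then have "finite ((\<lambda>(i, j). i + j) ` ?B)" by (rule finite_imageI)
  moreover have "?A = (\<lambda>(i, j). i + j) ` ?B" by auto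
  ultimately have "finite ?A" by simp
  then show ?thesis
    unfolding total_degree_def using assms by (intro le_cSup_finite) auto
qed

text \<open>The right-hand side is polynomial in \<open>s\<close>, and at \<open>s = 0\<close> only
  the form of degree \<open>d\<close> survives. This joins values near infinity continuously to the
  leading form.\<close>

lemma eval2_expand:
  assumes "\<And>i j. coeff (coeff g j) i \<noteq> 0 \<Longrightarrow> i + j \<le> d" "s \<noteq> 0"
  shows "s ^ d * eval2 g ((1 / s) *\<^sub>R z) = (\<Sum>k\<le>d. s ^ (d - k) * eval2 (hom_part k g) z)"
proof -
  have "g = (\<Sum>k\<le>d. hom_part k g)"
    by (rule bipoly_eqI) (use assms(1) in \<open>auto simp: coeff_sum coeff_hom_part\<close>)
  then have "eval2 g ((1 / s) *\<^sub>R z) = (\<Sum>k\<le>d. (1 / s) ^ k * eval2 (hom_part k g) z)"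
    by (metis (no_types, lifting) eval2_sum eval2_hom_part_scale sum.cong)
  moreover have "s ^ d * (1 / s) ^ k = s ^ (d - k)" if "k \<le> d" for k
    using that assms(2) by (simp add: power_diff power_divide)
  ultimately show ?thesis
    by (auto simp: sum_distrib_left mult.assoc[symmetric] intro!: sum.cong)
qed

section \<open>Critical zeros and double linear factors\<close>

lemma irreducible_monic_linear:
  fixes r :: "'a::idom"
  shows "irreducible [:- r, 1:]"
proof (rule irreducibleI)
  show "\<not> [:- r, 1:] dvd 1"
  proof
    assume "[:- r, 1:] dvd 1"
    then have "poly 1 r = 0" by (simp only: poly_eq_0_iff_dvd)
    then show False by simp
  qed
  fix p q assume pq: "[:- r, 1:] = p * q"
  then have nz: "p \<noteq> 0" "q \<noteq> 0" by auto
  have "degree p + degree q = 1"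
    using arg_cong[OF pq, of degree] nz by (simp add: degree_mult_eq)
  \<comment> \<open>The coefficients form only a domain, so a factor of degree 0 is a unit because
    its leading coefficient divides 1.\<close>
  moreover have "lead_coeff p * lead_coeff q = lead_coeff [:- r, 1:]"
    unfolding pq lead_coeff_mult ..
  then have "lead_coeff p * lead_coeff q = 1" by simp
  ultimately have deg: "degree p = 0 \<or> degree q = 0" and unit: "lead_coeff p dvd 1" "lead_coeff q dvd 1"
    by (auto intro: dvdI[of 1 "lead_coeff p" "lead_coeff q"] dvdI[of 1 "lead_coeff q" "lead_coeff p"] simp: mult.commute)
  have "p dvd 1" if "degree p = 0" "lead_coeff p dvd 1" for p :: "'a poly"
    using that by (auto elim!: degree_eq_zeroE simp: is_unit_const_poly_iff)
  then show "p dvd 1 \<or> q dvd 1" using deg unit by blast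
qed auto

text \<open>At a critical zero \<open>e\<close> the linear form vanishing at \<open>e\<close> is a
  double factor: \<open>x\<close> if \<open>e\<close> is on the vertical axis, otherwise
  \<open>y - (b / a) x\<close>.\<close>

lemma simple_real_factors_no_critical_zero:
  assumes "simple_real_factors (hom_part n f)" "e \<noteq> 0"
  shows "\<not> (eval2 (hom_part n f) e = 0 \<and> eval2 (dx (hom_part n f)) e = 0 \<and> eval2 (dy (hom_part n f)) e = 0)"
proof
  define g where "g = hom_part n f"
  assume *: "eval2 (hom_part n f) e = 0 \<and> eval2 (dx (hom_part n f)) e = 0 \<and> eval2 (dy (hom_part n f)) e = 0"
  then have g: "eval2 g e = 0" "eval2 (dx g) e = 0" "eval2 (dy g) e = 0" by (simp_all add: g_def)
  obtain a b where e: "e = (a, b)" by (cases e)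
  have "\<exists>p. irreducible p \<and> p\<^sup>2 dvd g"
  proof (cases "a = 0")
    case True
    then have b: "b \<noteq> 0" using assms(2) e by (auto simp: zero_prod_def)
    define X :: "real poly" where "X = [:0, 1:]"
    \<comment> \<open>Only the coefficients of \<open>y^n\<close> and \<open>x y^(n-1)\<close>
      matter; the value and the \<open>x\<close>-derivative at \<open>(0, b)\<close> determine
      them.\<close>
    have "coeff (coeff g j) i = 0" if "i < 2" for i j
    proof -
      have c: "coeff (coeff g j) i = (if i + j = n then coeff (coeff f j) i else 0)"
        by (simp add: g_def coeff_hom_part)
      have h0: "eval2 (hom_part k p) (0, b) = coeff (coeff p k) 0 * b ^ k" for k p
      proof -
        have "eval2 (hom_part k p) (0, b) = (\<Sum>j\<le>k. if j = k then coeff (coeff p k) 0 * b ^ k else 0)"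
          unfolding eval2_hom_part by (intro sum.cong) auto
        then show ?thesis by simp
      qed
      have 0: "coeff (coeff f n) 0 = 0" using g(1) b unfolding g_def e True h0 by simp
      moreover have "coeff (coeff f (n - 1)) 1 = 0" if "n > 0"
      proof -
        obtain k where n: "n = Suc k" using \<open>n > 0\<close> by (cases n) auto
        show ?thesis using g(2) b unfolding g_def e True n dx_hom_part h0 by (simp add: coeff_dx)
      qed
      moreover have "i = 0 \<or> i = 1" using that by auto
      ultimately show ?thesis unfolding c by (auto simp: gr0_conv_Suc)
    qed
    then have "monom 1 2 dvd coeff g j" for j
      by (auto simp: monom_1_dvd_iff')
    moreover have "X\<^sup>2 = monom 1 2" by (simp add: X_def monom_altdef)
    ultimately have "[:X\<^sup>2:] dvd g" by (simp add: const_poly_dvd_iff)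
    moreover have "[:X:]\<^sup>2 = [:X\<^sup>2:]" by (simp add: poly_const_pow)
    moreover have "irreducible [:X:]"
      unfolding irreducible_const_poly_iff X_def using irreducible_monic_linear[of "0::real"] by simp
    ultimately show ?thesis by metis
  next
    case False
    define r :: "real poly" where "r = [:0, b / a:]"
    \<comment> \<open>Substituting \<open>y = (b / a) x\<close> into a form of degree
      \<open>k\<close> leaves its value at \<open>e\<close> times \<open>(x / a)^k\<close>.\<close>
    have root: "poly (hom_part k p) r = monom (eval2 (hom_part k p) e / a ^ k) k" for k p
    proof (rule poly_eqI)
      have "poly (hom_part k p) r = (\<Sum>j\<le>k. monom (coeff (coeff p j) (k - j) * (b / a) ^ j) k)"
        unfolding hom_part_def poly_sum
      proof (intro sum.cong refl)
        fix j assume "j \<in> {..k}"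
        moreover have "r = monom (b / a) 1" by (simp add: r_def monom_altdef)
        ultimately show "poly (monom (monom (coeff (coeff p j) (k - j)) (k - j)) j) r
           = monom (coeff (coeff p j) (k - j) * (b / a) ^ j) k"
          by (simp add: poly_monom monom_power mult_monom)
      qed
      moreover have "(\<Sum>j\<le>k. coeff (coeff p j) (k - j) * (b / a) ^ j) = eval2 (hom_part k p) e / a ^ k"
        unfolding e eval2_hom_part sum_divide_distrib
      proof (intro sum.cong refl)
        fix j assume "j \<in> {..k}"
        then have "a ^ k = a ^ (k - j) * a ^ j" by (simp flip: power_add)
        then show "coeff (coeff p j) (k - j) * (b / a) ^ j
           = coeff (coeff p j) (k - j) * a ^ (k - j) * b ^ j / a ^ k"
          using False by (simp add: power_divide)
      qed
      ultimately show "coeff (poly (hom_part k p) r) i = coeff (monom (eval2 (hom_part k p) e / a ^ k) k) i" for i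
        by (auto simp: coeff_sum)
    qed
    have "poly g r = 0" using root g(1) by (simp add: g_def)
    then obtain q where q: "g = [:- r, 1:] * q" by (auto simp: poly_eq_0_iff_dvd)
    have "poly (dy g) r = 0"
    proof (cases n)
      case 0
      then have "dy g = 0" unfolding g_def by (intro bipoly_eqI) (simp add: coeff_dy coeff_hom_part)
      then show ?thesis by simp
    next
      case (Suc k)
      then show ?thesis using root[of k "dy f"] g(3) by (simp add: g_def dy_hom_part)
    qed
    \<comment> \<open>At the root \<open>r\<close> the \<open>y\<close>-derivative equals the
      cofactor \<open>q\<close>, so \<open>r\<close> is a double root.\<close>
    moreover have "dy g = q + [:- r, 1:] * pderiv q"
      unfolding q dy_def pderiv_mult by (simp add: pderiv_pCons)
    ultimately have "poly q r = 0" by simp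
    then have "[:- r, 1:] dvd q" by (simp only: poly_eq_0_iff_dvd)
    then have "[:- r, 1:]\<^sup>2 dvd g" unfolding q power2_eq_square by (rule mult_dvd_mono[OF dvd_refl])
    then show ?thesis using irreducible_monic_linear by blast
  qed
  then obtain p where "irreducible p" "p\<^sup>2 dvd g" by blast
  moreover then have "p dvd g" using dvd_trans[of p "p\<^sup>2" g] by (simp add: power2_eq_square)
  ultimately show False using assms(1) unfolding simple_real_factors_def g_def by blast
qed

section \<open>The form of highest degree and the behaviour at infinity\<close>

text \<open>The inequality says that the \<open>n\<close>-th root of \<open>\<phi>\<close> is
  concave. Being positive on the whole line, it is constant, since a sloping tangent would fall to
  zero.\<close>

lemma positive_concave_root_constant:
  fixes \<phi> \<phi>' \<phi>'' :: "real \<Rightarrow> real" and n :: nat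
  assumes pos: "\<And>u. \<phi> u > 0" and n: "n > 0"
    and d1: "\<And>u. (\<phi> has_real_derivative \<phi>' u) (at u)"
    and d2: "\<And>u. (\<phi>' has_real_derivative \<phi>'' u) (at u)"
    and ineq: "\<And>u. real n * \<phi> u * \<phi>'' u \<le> (real n - 1) * (\<phi>' u)\<^sup>2"
  shows "\<phi>' u = 0"
proof (rule ccontr)
  assume nz: "\<phi>' u \<noteq> 0"
  define \<alpha> where "\<alpha> = 1 / real n"
  define G where "G = (\<lambda>u. \<phi> u powr \<alpha>)"
  define K where "K = (\<lambda>u. \<alpha> * \<phi> u powr (\<alpha> - 1) * \<phi>' u)"
  define L where "L = (\<lambda>u. \<alpha> * \<phi> u powr (\<alpha> - 2) * (\<phi> u * \<phi>'' u + (\<alpha> - 1) * (\<phi>' u)\<^sup>2))"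
  have G: "((\<lambda>u. - G u) has_real_derivative - K u) (at u)" for u
    unfolding G_def K_def by (rule derivative_eq_intros d1 pos refl | simp)+
  have K: "((\<lambda>u. - K u) has_real_derivative - L u) (at u)" for u
  proof -
    have "\<phi> u powr (\<alpha> - 1) = \<phi> u powr (\<alpha> - 2) * \<phi> u"
      using pos[of u] powr_add[of "\<phi> u" "\<alpha> - 2" 1] by (simp add: powr_one)
    then have "L u = \<alpha> * ((\<alpha> - 1) * \<phi> u powr (\<alpha> - 1 - 1) * \<phi>' u) * \<phi>' u + \<alpha> * \<phi> u powr (\<alpha> - 1) * \<phi>'' u"
      unfolding L_def by (simp add: algebra_simps power2_eq_square)
    moreover have "(K has_real_derivative \<alpha> * ((\<alpha> - 1) * \<phi> u powr (\<alpha> - 1 - 1) * \<phi>' u) * \<phi>' u + \<alpha> * \<phi> u powr (\<alpha> - 1) * \<phi>'' u) (at u)"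
      unfolding K_def by (rule derivative_eq_intros d1 d2 pos refl | simp)+
    ultimately show ?thesis by (intro derivative_intros) simp
  qed
  have L: "0 \<le> - L u" for u
  proof -
    have "real n * (\<phi> u * \<phi>'' u + (\<alpha> - 1) * (\<phi>' u)\<^sup>2) \<le> 0"
      using ineq[of u] n by (simp add: \<alpha>_def algebra_simps)
    then have "\<phi> u * \<phi>'' u + (\<alpha> - 1) * (\<phi>' u)\<^sup>2 \<le> 0"
      using n by (simp add: mult_le_0_iff)
    moreover have "0 \<le> \<alpha> * \<phi> u powr (\<alpha> - 2)" by (simp add: \<alpha>_def)
    ultimately show ?thesis unfolding L_def by (simp only: neg_0_le_iff_le mult_nonneg_nonpos)
  qed
  have "convex_on UNIV (\<lambda>u. - G u)"
    by (rule f''_ge0_imp_convex[OF _ G K L]) auto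
  then have tangent: "- G x - - G u \<ge> - K u * (x - u)" for x
    by (rule convex_on_imp_above_tangent) (use G in auto)
  have Gpos: "G x > 0" for x using pos[of x] by (simp add: G_def)
  have "K u \<noteq> 0" using nz pos[of u] n by (simp add: K_def \<alpha>_def)
  \<comment> \<open>The chosen point is where the tangent line to \<open>G\<close> at
    \<open>u\<close> vanishes.\<close>
  then have "G (u - G u / K u) \<le> 0" using tangent[of "u - G u / K u"] by simp
  then show False using Gpos[of "u - G u / K u"] by simp
qed

text \<open>At a zero of \<open>F\<close> the point \<open>F + i F'\<close> crosses the imaginary
  axis clockwise. Hence the angle can pass the value \<open>\<theta> s\<close> only downwards and
  stays below it; at \<open>t\<close> it differs from it by a multiple of pi.\<close>

lemma angle_decreases_between_zeros:
  fixes F F' \<rho> \<theta> :: "real \<Rightarrow> real"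
  assumes F: "\<And>t. (F has_real_derivative F' t) (at t)"
    and polar: "\<And>t. F t = \<rho> t * cos (\<theta> t)" "\<And>t. F' t = \<rho> t * sin (\<theta> t)"
    and \<rho>: "\<And>t. \<rho> t > 0" and \<theta>: "continuous_on UNIV \<theta>"
    and st: "s < t" "F s = 0" "F t = 0"
  shows "\<theta> t \<le> \<theta> s - pi"
proof -
  define c where "c = \<theta> s"
  have cosc: "cos c = 0" using polar(1)[of s] st \<rho>[of s] by (simp add: c_def)
  have sinc: "sin c * sin c = 1" using sin_cos_squared_add[of c] cosc by (simp add: power2_eq_square)
  \<comment> \<open>\<open>sin c\<close> is 1 or -1, so the sign of \<open>F x * sin c\<close>
    reveals that of \<open>\<theta> x - c\<close> while this difference is below pi in absolute
    value.\<close>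
  have Fc: "F x * sin c = - \<rho> x * sin (\<theta> x - c)" for x
  proof -
    have "sin (\<theta> x - c) = - cos (\<theta> x) * sin c" using cosc by (simp add: sin_diff)
    then show ?thesis using polar(1)[of x] by simp
  qed
  have near: "\<exists>d>0. \<forall>y. \<bar>y - x\<bar> < d \<longrightarrow> (x < y \<longrightarrow> \<theta> y < c) \<and> (y < x \<longrightarrow> \<theta> y > c)" if x: "\<theta> x = c" for x
  proof -
    have "F' x * sin c = \<rho> x * (sin c * sin c)" using polar(2)[of x] x by simp
    then have "F' x * sin c > 0" using sinc \<rho>[of x] by simp
    moreover have "((\<lambda>x. F x * sin c) has_real_derivative F' x * sin c) (at x)"
      by (rule DERIV_cmult_right[OF F])
    moreover have "F x * sin c = 0" using Fc[of x] x by simp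
    ultimately have "\<exists>d>0. \<forall>h>0. h < d \<longrightarrow> F x * sin c < F (x + h) * sin c"
        "\<exists>d>0. \<forall>h>0. h < d \<longrightarrow> F (x - h) * sin c < F x * sin c" "F x * sin c = 0"
      using DERIV_pos_inc_right[of "\<lambda>x. F x * sin c" "F' x * sin c" x]
        DERIV_pos_inc_left[of "\<lambda>x. F x * sin c" "F' x * sin c" x] by auto
    then obtain d1 d2 where d: "d1 > 0" "d2 > 0"
      "\<And>h. h > 0 \<Longrightarrow> h < d1 \<Longrightarrow> F (x + h) * sin c > 0" "\<And>h. h > 0 \<Longrightarrow> h < d2 \<Longrightarrow> F (x - h) * sin c < 0"
      by metis
    obtain d3 where d3: "d3 > 0" "\<And>y. \<bar>y - x\<bar> < d3 \<Longrightarrow> \<bar>\<theta> y - c\<bar> < pi"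
    proof -
      have "isCont \<theta> x" using \<theta> by (simp add: continuous_on_eq_continuous_at)
      then obtain d where "d > 0" "\<And>y. dist y x < d \<Longrightarrow> dist (\<theta> y) (\<theta> x) < pi"
        unfolding continuous_at_eps_delta using pi_gt_zero by metis
      then show ?thesis using that x by (simp add: dist_real_def)
    qed
    show ?thesis
    proof (intro exI[of _ "min d3 (min d1 d2)"] conjI allI impI)
      show "0 < min d3 (min d1 d2)" using d d3 by simp
      fix y assume y: "\<bar>y - x\<bar> < min d3 (min d1 d2)"
      then have b: "\<bar>\<theta> y - c\<bar> < pi" using d3 by simp
      show "\<theta> y < c" if "x < y"
      proof -
        have "F y * sin c > 0" using d(3)[of "y - x"] y that by simp
        then have "sin (\<theta> y - c) < 0" using Fc[of y] \<rho>[of y] by (simp add: zero_less_mult_iff mult_less_0_iff)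
        then show ?thesis using b sin_ge_zero[of "\<theta> y - c"] by argo
      qed
      show "\<theta> y > c" if "y < x"
      proof -
        have "F y * sin c < 0" using d(4)[of "x - y"] y that by simp
        then have "sin (\<theta> y - c) > 0" using Fc[of y] \<rho>[of y] by (simp add: zero_less_mult_iff mult_less_0_iff)
        moreover have "sin (c - \<theta> y) = - sin (\<theta> y - c)" by (simp flip: sin_minus)
        ultimately show ?thesis using b sin_ge_zero[of "c - \<theta> y"] by argo
      qed
    qed
  qed
  have below: "\<theta> t < c"
  proof (rule ccontr)
    assume "\<not> \<theta> t < c"
    obtain d where d: "d > 0" "\<And>y. \<bar>y - s\<bar> < d \<Longrightarrow> s < y \<Longrightarrow> \<theta> y < c"
      using near[of s] by (auto simp: c_def)
    define s' where "s' = s + min (d / 2) ((t - s) / 2)"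
    have s': "s < s'" "s' < t" "\<bar>s' - s\<bar> < d" using d(1) st(1) by (auto simp: s'_def min_def field_simps)
    \<comment> \<open>The least element of \<open>Z\<close> is the first return to the level
      \<open>c\<close>: the angle is below \<open>c\<close> just before it, whereas a downward
      crossing needs it above.\<close>
    define Z where "Z = {x \<in> {s'..t}. c \<le> \<theta> x}"
    have "closed Z"
      unfolding Z_def by (intro closed_Collect_le continuous_on_closed_Collect_le continuous_intros continuous_on_subset[OF \<theta>]) auto
    moreover have "Z \<subseteq> {s'..t}" by (auto simp: Z_def)
    ultimately have "compact Z" using compact_Int_closed[OF compact_Icc, of Z s' t] by (simp add: inf.absorb2)
    moreover have "t \<in> Z" using \<open>\<not> \<theta> t < c\<close> s' by (simp add: Z_def)
    ultimately obtain x where x: "x \<in> Z" "\<And>y. y \<in> Z \<Longrightarrow> x \<le> y"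
      using compact_attains_inf[of Z] by blast
    have xs': "s' < x" using x(1) d(2)[OF s'(3,1)] by (cases "x = s'") (auto simp: Z_def)
    have lt: "\<theta> y < c" if "s' \<le> y" "y < x" for y
    proof (rule ccontr)
      assume "\<not> \<theta> y < c"
      then have "y \<in> Z" using that x(1) by (auto simp: Z_def)
      then show False using x(2) that by force
    qed
    have "\<theta> x = c"
    proof (rule ccontr)
      assume "\<theta> x \<noteq> c"
      then have "\<theta> x > c" using x(1) by (simp add: Z_def)
      moreover have "\<theta> s' < c" using lt[of s'] xs' by simp
      ultimately obtain y where "s' \<le> y" "y \<le> x" "\<theta> y = c"
        using IVT'[of \<theta> s' c x] xs' continuous_on_subset[OF \<theta>] by fastforce
      then show False using lt[of y] \<open>\<theta> x \<noteq> c\<close> by (cases "y = x") auto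
    qed
    then obtain d' where d': "d' > 0" "\<And>y. \<bar>y - x\<bar> < d' \<Longrightarrow> y < x \<Longrightarrow> \<theta> y > c"
      using near[of x] by blast
    define y where "y = x - min (d' / 2) ((x - s') / 2)"
    have "s' \<le> y" "y < x" "\<bar>y - x\<bar> < d'" using d' xs' by (auto simp: y_def min_def field_simps)
    then show False using lt[of y] d'(2)[of y] by simp
  qed
  show ?thesis
  proof (rule ccontr)
    assume "\<not> ?thesis"
    then have "0 < c - \<theta> t" "c - \<theta> t < pi" using below by (auto simp: c_def)
    then have "sin (c - \<theta> t) > 0" by (rule sin_gt_zero)
    moreover have "sin (\<theta> t - c) = 0" using Fc[of t] st \<rho>[of t] by simp
    moreover have "sin (c - \<theta> t) = - sin (\<theta> t - c)" by (simp flip: sin_minus)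
    ultimately show False by simp
  qed
qed

text \<open>By periodicity \<open>Arg\<close> and \<open>Arg2pi\<close> give the same value of
  \<open>g\<close>, and each of them is continuous where the other jumps.\<close>

lemma has_log_circle_of_periodic:
  assumes g: "continuous_on UNIV g" "\<And>t. U (cis t) = exp (g t)" "\<And>t. g (t + 2 * pi) = g t"
  shows "has_log (sphere 0 1) U"
proof -
  have per: "g (Arg z) = g (Arg2pi z)" if "z \<in> sphere 0 1" for z
  proof -
    have "z \<noteq> 0" using that by auto
    have lt: "Arg z < 2 * pi" "0 \<le> Arg z + 2 * pi"
      using Arg_le_pi[of z] mpi_less_Arg[of z] pi_gt_zero by linarith+
    have "Arg2pi z = Arg z \<or> Arg2pi z = Arg z + 2 * pi"
    proof (cases "0 \<le> Arg z")
      case True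
      then have "Arg2pi z = Arg z"
        using cis_Arg[OF \<open>z \<noteq> 0\<close>] lt that by (intro Arg2pi_unique[of "1"]) (auto simp: cis_conv_exp sgn_div_norm)
      then show ?thesis ..
    next
      case False
      moreover have "exp (\<i> * (2 * complex_of_real pi)) = 1"
        by (metis exp_two_pi_i' mult.commute)
      ultimately have "Arg2pi z = Arg z + 2 * pi"
        using cis_Arg[OF \<open>z \<noteq> 0\<close>] lt that
        by (intro Arg2pi_unique[of "1"]) (auto simp: cis_conv_exp sgn_div_norm exp_add distrib_left)
      then show ?thesis ..
    qed
    then show ?thesis using g(3) by auto
  qed
  show ?thesis
  proof (rule has_logI)
    have gat: "isCont g t" for t using g(1) by (simp add: continuous_on_eq_continuous_at)
    show "continuous_on (sphere 0 1) (\<lambda>z. g (Arg z))"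
      unfolding continuous_on_eq_continuous_within
    proof
      fix z :: complex assume z: "z \<in> sphere 0 1"
      show "continuous (at z within sphere 0 1) (\<lambda>z. g (Arg z))"
      proof (cases "z \<in> \<real>\<^sub>\<le>\<^sub>0")
        case False
        then show ?thesis
          by (intro continuous_within_compose3[OF gat continuous_within_Arg])
      next
        case True
        moreover have "z \<noteq> 0" using z by auto
        ultimately have "z \<notin> \<real>\<^sub>\<ge>\<^sub>0" by (auto simp: complex_nonpos_Reals_iff complex_nonneg_Reals_iff complex_eq_iff)
        then have "continuous (at z within sphere 0 1) (\<lambda>z. g (Arg2pi z))"
          by (intro continuous_within_compose3[OF gat continuous_at_imp_continuous_within] continuous_at_Arg2pi)
        then show ?thesis
          by (rule continuous_transform_within[OF _ zero_less_one z]) (use per in auto)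
      qed
    qed
    fix z :: complex assume "z \<in> sphere 0 1"
    moreover then have "z \<noteq> 0" by auto
    ultimately have "cis (Arg z) = z" using cis_Arg[of z] by (simp add: sgn_div_norm)
    then show "U z = exp (g (Arg z))" using g(2)[of "Arg z"] by simp
  qed
qed

text \<open>The zeros \<open>t0\<close>, \<open>t1\<close> and their translates by pi force four
  drops of pi in one turn, so \<open>F + i F'\<close> has winding number at most -2, written
  \<open>-(k + 2)\<close>.\<close>

lemma circle_winding_bound:
  fixes F F' :: "real \<Rightarrow> real"
  assumes F: "\<And>t. (F has_real_derivative F' t) (at t)" and F': "continuous_on UNIV F'"
    and nz: "\<And>t. F t \<noteq> 0 \<or> F' t \<noteq> 0"
    and U: "\<And>t. U (cis t) = Complex (F t) (F' t)"
    and anti: "\<And>t. \<bar>F (t + pi)\<bar> = \<bar>F t\<bar>"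
    and zeros: "t0 < t1" "t1 < t0 + pi" "F t0 = 0" "F t1 = 0"
  obtains k where "has_log (sphere 0 1) (\<lambda>z. U z * z ^ (k + 2))"
proof -
  have contF: "continuous_on UNIV F" using F by (meson DERIV_isCont continuous_at_imp_continuous_on)
  have c1: "continuous_on UNIV (\<lambda>t. Complex (F t) (F' t))"
    by (intro continuous_intros contF F')
  have c2: "contractible (UNIV :: real set)" by (simp add: convex_imp_contractible)
  have c3: "Complex (F t) (F' t) \<noteq> 0" for t using nz[of t] by (auto simp: complex_eq_iff)
  obtain g where g: "continuous_on UNIV g" "\<And>t. Complex (F t) (F' t) = exp (g t)"
    by (rule continuous_logarithm_on_contractible[OF c1 c2 c3]) blast+
  have polar: "F t = exp (Re (g t)) * cos (Im (g t))" "F' t = exp (Re (g t)) * sin (Im (g t))" for t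
    using g(2)[of t] by (auto simp: complex_eq_iff Re_exp Im_exp)
  have drop: "Im (g t) \<le> Im (g s) - pi" if "s < t" "F s = 0" "F t = 0" for s t
    by (rule angle_decreases_between_zeros[OF F polar _ _ that]) (auto intro!: continuous_intros g(1))
  have per: "\<exists>m::int. g (t + 2 * pi) - g t = 2 * of_int m * pi * \<i>" for t
  proof -
    have "cis (t + 2 * pi) = cis t" by (simp add: complex_eq_iff)
    then have "exp (g (t + 2 * pi)) = exp (g t)" using U g(2) by metis
    then obtain m :: int where "g (t + 2 * pi) = g t + (of_int (2 * m) * pi) * \<i>" using exp_eq by blast
    then show ?thesis by (intro exI[of _ m]) simp
  qed
  \<comment> \<open>The increment over a period is continuous with values in the integer multiples
    of \<open>2 pi i\<close>, hence constant.\<close>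
  have "(\<lambda>t. g (t + 2 * pi) - g t) constant_on UNIV"
  proof (rule continuous_discrete_range_constant)
    show "continuous_on UNIV (\<lambda>t. g (t + 2 * pi) - g t)"
      by (intro continuous_intros g(1) continuous_on_compose2[OF g(1)]) auto
    show "\<exists>e>0. \<forall>y. y \<in> UNIV \<and> g (y + 2 * pi) - g y \<noteq> g (x + 2 * pi) - g x \<longrightarrow>
         e \<le> norm (g (y + 2 * pi) - g y - (g (x + 2 * pi) - g x))" for x
    proof (intro exI[of _ 1] conjI allI impI)
      fix y assume ne: "y \<in> UNIV \<and> g (y + 2 * pi) - g y \<noteq> g (x + 2 * pi) - g x"
      obtain m l :: int where m: "g (y + 2 * pi) - g y = 2 * of_int m * pi * \<i>"
        "g (x + 2 * pi) - g x = 2 * of_int l * pi * \<i>" using per by metis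
      then have "m \<noteq> l" using ne by auto
      then have "1 \<le> \<bar>of_int (m - l) :: real\<bar>" by linarith
      have "norm (g (y + 2 * pi) - g y - (g (x + 2 * pi) - g x)) = norm (complex_of_real (2 * pi * of_int (m - l)) * \<i>)"
        unfolding m by (simp add: algebra_simps)
      also have "\<dots> = 2 * pi * \<bar>of_int (m - l)\<bar>" by (simp add: norm_mult abs_mult del: of_int_diff of_real_mult)
      also have "\<dots> \<ge> 1 * 1" using \<open>1 \<le> _\<close> pi_ge_two by (intro mult_mono) auto
      finally show "1 \<le> norm (g (y + 2 * pi) - g y - (g (x + 2 * pi) - g x))" by simp
    qed simp
  qed simp
  then obtain l where l: "\<And>t. g (t + 2 * pi) - g t = l" unfolding constant_on_def by auto
  obtain m :: int where m: "l = 2 * of_int m * pi * \<i>" using per l by metis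
  have z: "F (t0 + pi) = 0" "F (t1 + pi) = 0" "F (t0 + 2 * pi) = 0"
    using anti[of t0] anti[of t1] anti[of "t0 + pi"] zeros by (auto simp: algebra_simps)
  have "Im (g (t0 + 2 * pi)) \<le> Im (g t0) - 4 * pi"
    using drop[of t0 t1] drop[of t1 "t0 + pi"] drop[of "t0 + pi" "t1 + pi"] drop[of "t1 + pi" "t0 + 2 * pi"]
      z zeros by simp
  then have "Im l \<le> - 4 * pi" using l[of t0] by auto
  then have "2 * real_of_int m * pi \<le> (- 4) * pi" by (simp add: m)
  then have "2 * real_of_int m \<le> - 4" by (simp only: mult_le_cancel_right_pos[OF pi_gt_zero])
  then have "m \<le> - 2" by linarith
  then obtain k where k: "m = - int (k + 2)"
    by (intro that[of "nat (- m - 2)"]) auto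
  have "has_log (sphere 0 1) (\<lambda>z. U z * z ^ (k + 2))"
  proof (rule has_log_circle_of_periodic)
    show "continuous_on UNIV (\<lambda>t. g t + of_real (real (k + 2) * t) * \<i>)" by (intro continuous_intros g(1))
    show "U (cis t) * cis t ^ (k + 2) = exp (g t + of_real (real (k + 2) * t) * \<i>)" for t
      unfolding U g(2) exp_add Complex.DeMoivre by (simp add: cis_conv_exp mult_ac)
    show "g (t + 2 * pi) + of_real (real (k + 2) * (t + 2 * pi)) * \<i> = g t + of_real (real (k + 2) * t) * \<i>" for t
      using l[of t] unfolding m k by (simp add: algebra_simps)
  qed
  then show thesis by (rule that)
qed

section \<open>The leading form and \<open>spin\<close> on large circles\<close>

abbreviation plane_point :: "complex \<Rightarrow> real \<times> real" where
  "plane_point z \<equiv> (Re z, Im z)"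

text \<open>The argument of \<open>spin f z\<close> is twice the argument of an eigenvector of the Hessian matrix; where that matrix
  is singular, the asymptotic direction is an eigenvector for the eigenvalue 0.\<close>

definition spin :: "bipoly \<Rightarrow> complex \<Rightarrow> complex" where
  "spin f z = Complex (eval2 (dx (dx f)) (plane_point z) - eval2 (dy (dy f)) (plane_point z))
     (2 * eval2 (dx (dy f)) (plane_point z))"

lemma eval2_hess: "eval2 (hess f) q = eval2 (dx (dx f)) q * eval2 (dy (dy f)) q - (eval2 (dx (dy f)) q)\<^sup>2"
  by (simp add: hess_def)

lemma second_euler_hom_part:
  fixes f :: bipoly
  assumes "k \<ge> 1"
  defines "g \<equiv> hom_part k f"
  shows "x * eval2 (dx (dx g)) (x, y) + y * eval2 (dx (dy g)) (x, y) = (real k - 1) * eval2 (dx g) (x, y)"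
    and "x * eval2 (dx (dy g)) (x, y) + y * eval2 (dy (dy g)) (x, y) = (real k - 1) * eval2 (dy g) (x, y)"
proof -
  obtain m where k: "k = Suc m" using assms by (cases k) auto
  show "x * eval2 (dx (dx g)) (x, y) + y * eval2 (dx (dy g)) (x, y) = (real k - 1) * eval2 (dx g) (x, y)"
    using euler_hom_part[of "(x, y)" m "dx f"] unfolding g_def dx_dy_commute k dx_hom_part by simp
  show "x * eval2 (dx (dy g)) (x, y) + y * eval2 (dy (dy g)) (x, y) = (real k - 1) * eval2 (dy g) (x, y)"
    using euler_hom_part[of "(x, y)" m "dy f"] unfolding g_def k dy_hom_part by simp
qed

text \<open>Restrict the form to a line parallel to a zero direction (any direction if there is none).
  If it has no zero on that line, then its \<open>n\<close>-th root is positive and concave there, hence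
  constant, and the direction is a multiple zero.\<close>

lemma hyperbolic_form_two_zero_directions:
  assumes n: "n \<ge> 2"
    and simple: "\<And>e. e \<noteq> 0 \<Longrightarrow> \<not> (eval2 (hom_part n f) e = 0 \<and> eval2 (dx (hom_part n f)) e = 0 \<and> eval2 (dy (hom_part n f)) e = 0)"
    and hyp: "\<And>z. z \<noteq> 0 \<Longrightarrow> eval2 (hess (hom_part n f)) z \<le> 0"
  obtains t0 t1 where "t0 < t1" "t1 < t0 + pi"
    "eval2 (hom_part n f) (cos t0, sin t0) = 0" "eval2 (hom_part n f) (cos t1, sin t1) = 0"
proof (rule ccontr)
  assume neg: "\<not> thesis"
  define g where "g = hom_part n f"
  define F where "F = (\<lambda>t. eval2 g (cos t, sin t))"
  \<comment> \<open>If \<open>F\<close> has a zero, the negated claim excludes another one within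
    the next half turn; otherwise any \<open>t0\<close> will do.\<close>
  have "\<exists>t0. \<forall>t. t0 < t \<and> t < t0 + pi \<longrightarrow> F t \<noteq> 0"
  proof (cases "\<exists>t. F t = 0")
    case True
    then show ?thesis using neg that unfolding F_def g_def by blast
  qed auto
  then obtain t0 where t0: "\<And>t. t0 < t \<Longrightarrow> t < t0 + pi \<Longrightarrow> F t \<noteq> 0" by blast
  define c s where "c = cos t0" and "s = sin t0"
  have cs: "c * c + s * s = 1" using sin_cos_squared_add[of t0] by (simp add: c_def s_def power2_eq_square)
  have scale: "eval2 g (r * x, r * y) = r ^ n * eval2 g (x, y)" for r x y
    using eval2_hom_part_scale[of n f r "(x, y)"] by (simp add: g_def)
  define \<phi> where "\<phi> u = eval2 g (- s + u * c, c + u * s)" for u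
  define \<phi>' where "\<phi>' u = eval2 (dx g) (- s + u * c, c + u * s) * c + eval2 (dy g) (- s + u * c, c + u * s) * s" for u
  define \<phi>'' where "\<phi>'' u = (eval2 (dx (dx g)) (- s + u * c, c + u * s) * c + eval2 (dx (dy g)) (- s + u * c, c + u * s) * s) * c
     + (eval2 (dx (dy g)) (- s + u * c, c + u * s) * c + eval2 (dy (dy g)) (- s + u * c, c + u * s) * s) * s" for u
  have line: "((\<lambda>u. eval2 p (- s + u * c, c + u * s)) has_real_derivative
      eval2 (dx p) (- s + u * c, c + u * s) * c + eval2 (dy p) (- s + u * c, c + u * s) * s) (at u)" for p u
  proof -
    have "((\<lambda>u. (- s + u * c, c + u * s)) has_derivative (\<lambda>v. (v * c, v * s))) (at u)"
      by (auto intro!: derivative_eq_intros)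
    from has_derivative_compose[OF this eval2_has_derivative[of p]]
    show ?thesis unfolding has_field_derivative_def
      by (rule has_derivative_eq_rhs) (auto simp: fun_eq_iff algebra_simps)
  qed
  have d1: "(\<phi> has_real_derivative \<phi>' u) (at u)" for u
    unfolding \<phi>_def[abs_def] \<phi>'_def by (rule line)
  have d2: "(\<phi>' has_real_derivative \<phi>'' u) (at u)" for u
    unfolding \<phi>'_def[abs_def] \<phi>''_def
    using DERIV_add[OF DERIV_cmult_right[OF line[of "dx g" u], of c] DERIV_cmult_right[OF line[of "dy g" u], of s]]
    by (simp add: dx_dy_commute)
  have off_axis: "(- s + u * c, c + u * s) \<noteq> 0" for u
  proof
    assume "(- s + u * c, c + u * s) = 0"
    then have "(- s + u * c) * (- s) + (c + u * s) * c = 0" by (simp add: zero_prod_def)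
    then show False using cs by (simp add: algebra_simps)
  qed
  have \<phi>nz: "\<phi> u \<noteq> 0" for u
  proof
    assume "\<phi> u = 0"
    \<comment> \<open>\<open>r\<close> is the distance of the point from 0; its direction has angle
      \<open>t0 + t\<close> with \<open>t\<close> strictly between 0 and pi.\<close>
    define r where "r = sqrt (1 + u\<^sup>2)"
    have r: "r > 0" "r\<^sup>2 = 1 + u\<^sup>2" unfolding r_def by (simp_all add: add_pos_nonneg)
    have "\<bar>u / r\<bar> < 1"
    proof -
      have "\<bar>u\<bar>\<^sup>2 < r\<^sup>2" using r by simp
      then have "\<bar>u\<bar> < r" using r(1) by (meson less_imp_le power_less_imp_less_base)
      then show ?thesis using r(1) by (simp add: abs_divide)
    qed
    then have ur: "- 1 < u / r" "u / r < 1" by linarith+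
    define t where "t = arccos (u / r)"
    have t: "0 < t" "t < pi" "cos t = u / r"
      using arccos_lt_bounded[of "u / r"] cos_arccos[of "u / r"] ur
      unfolding t_def abs_less_iff by auto
    have "(sin t)\<^sup>2 = (1 / r)\<^sup>2"
    proof -
      have "(sin t)\<^sup>2 = 1 - (u / r)\<^sup>2" using t(3) by (simp add: sin_squared_eq)
      also have "\<dots> = (r\<^sup>2 - u\<^sup>2) / r\<^sup>2" using r(1) by (simp add: power_divide diff_divide_distrib)
      finally show ?thesis using r(2) by (simp add: power_divide)
    qed
    then have st: "sin t = 1 / r"
      using sin_gt_zero[OF t(1,2)] r(1) by (simp add: power2_eq_iff) (smt (verit) zero_less_divide_1_iff)
    have "r * cos (t0 + t) = - s + u * c" "r * sin (t0 + t) = c + u * s"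
      using r(1) by (simp_all add: cos_add sin_add st t(3) c_def s_def field_simps)
    then have "r ^ n * F (t0 + t) = 0"
      using scale[of r "cos (t0 + t)" "sin (t0 + t)"] \<open>\<phi> u = 0\<close> by (simp add: F_def \<phi>_def)
    then show False using t0[of "t0 + t"] t r(1) by simp
  qed
  define \<epsilon> where "\<epsilon> = sgn (\<phi> 0)"
  have \<epsilon>: "\<epsilon> * \<epsilon> = 1" using \<phi>nz[of 0] by (auto simp: \<epsilon>_def sgn_if)
  have pos: "\<epsilon> * \<phi> u > 0" for u
  proof (rule ccontr)
    assume "\<not> \<epsilon> * \<phi> u > 0"
    moreover have "\<epsilon> * \<phi> 0 > 0" using \<phi>nz[of 0] by (auto simp: \<epsilon>_def sgn_if)
    moreover have "is_interval ((\<lambda>u. \<epsilon> * \<phi> u) ` UNIV)"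
      unfolding is_interval_connected_1 using d1
      by (intro connected_continuous_image continuous_intros)
        (auto intro!: continuous_at_imp_continuous_on DERIV_isCont)
    ultimately have "0 \<in> (\<lambda>u. \<epsilon> * \<phi> u) ` UNIV"
      unfolding is_interval_1 by (metis less_imp_le not_less rangeI)
    then show False using \<phi>nz \<epsilon> by auto
  qed
  have ineq: "real n * (\<epsilon> * \<phi> u) * (\<epsilon> * \<phi>'' u) \<le> (real n - 1) * (\<epsilon> * \<phi>' u)\<^sup>2" for u
  proof -
    define x y where "x = - s + u * c" and "y = c + u * s"
    define A B C X Y P where "A = eval2 (dx (dx g)) (x, y)" and "B = eval2 (dx (dy g)) (x, y)"
      and "C = eval2 (dy (dy g)) (x, y)" and "X = eval2 (dx g) (x, y)" and "Y = eval2 (dy g) (x, y)"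
      and "P = eval2 g (x, y)"
    have E: "x * A + y * B = (real n - 1) * X" "x * B + y * C = (real n - 1) * Y"
      using second_euler_hom_part[of n x f y] n unfolding g_def A_def B_def C_def X_def Y_def by auto
    have E1: "x * X + y * Y = real n * P"
      using euler_hom_part[of "(x, y)" n f] unfolding g_def X_def Y_def P_def by simp
    have "A * C - B\<^sup>2 \<le> 0"
      using hyp[OF off_axis[of u]] unfolding eval2_hess A_def B_def C_def g_def x_def y_def by simp
    then have le: "(A * C - B\<^sup>2) * (x * s - y * c)\<^sup>2 \<le> 0" by (simp add: mult_le_0_iff)
    \<comment> \<open>Gram determinant of the Hessian form on \<open>(x, y)\<close> and
      \<open>(c, s)\<close>; Euler's identity turns its entries into \<open>\<phi>\<close> and its
      derivatives.\<close>
    have gram: "(A * C - B\<^sup>2) * (x * s - y * c)\<^sup>2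
      = (x * (x * A + y * B) + y * (x * B + y * C)) * ((A * c + B * s) * c + (B * c + C * s) * s)
        - ((x * A + y * B) * c + (x * B + y * C) * s)\<^sup>2"
      by (simp add: algebra_simps power2_eq_square)
    have zz: "x * (x * A + y * B) + y * (x * B + y * C) = (real n - 1) * (real n * P)"
      unfolding E E1[symmetric] by (simp add: algebra_simps)
    have ze: "(x * A + y * B) * c + (x * B + y * C) * s = (real n - 1) * \<phi>' u"
      unfolding E by (simp add: \<phi>'_def X_def Y_def x_def y_def algebra_simps)
    have ee: "(A * c + B * s) * c + (B * c + C * s) * s = \<phi>'' u"
      by (simp add: \<phi>''_def A_def B_def C_def x_def y_def)
    have "P = \<phi> u" by (simp add: \<phi>_def P_def x_def y_def)
    then have "(real n - 1) * (real n * \<phi> u * \<phi>'' u - (real n - 1) * (\<phi>' u)\<^sup>2) \<le> 0"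
      using le unfolding gram zz ze ee by (simp add: right_diff_distrib power_mult_distrib power2_eq_square mult_ac)
    then have "real n * \<phi> u * \<phi>'' u \<le> (real n - 1) * (\<phi>' u)\<^sup>2"
      using n by (simp add: mult_le_0_iff)
    then have "(\<epsilon> * \<epsilon>) * (real n * \<phi> u * \<phi>'' u) \<le> (\<epsilon> * \<epsilon>) * ((real n - 1) * (\<phi>' u)\<^sup>2)"
      unfolding \<epsilon> by simp
    then show ?thesis by (simp add: power2_eq_square mult_ac)
  qed
  have "\<epsilon> * \<phi>' u = 0" for u
    by (rule positive_concave_root_constant[OF pos _ DERIV_cmult[OF d1] DERIV_cmult[OF d2] ineq]) (use n in simp)
  then have "\<phi>' u = 0" for u using \<epsilon> by (metis mult_eq_0_iff zero_neq_one)
  then have const: "\<phi> u = \<phi> 0" for u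
    using d1 DERIV_isconst_all[of \<phi> u 0] by metis
  \<comment> \<open>Crosses the direction \<open>(c, s)\<close> transversally. Homogeneity and the
    constancy of \<open>\<phi>\<close> give \<open>\<phi> 0 * v ^ n\<close>, which vanishes at 0
    together with its derivative because \<open>n \<ge> 2\<close>.\<close>
  define q where "q v = eval2 g (c + v * (- s), s + v * c)" for v
  have q': "(q has_real_derivative eval2 (dx g) (c + v * (- s), s + v * c) * (- s) + eval2 (dy g) (c + v * (- s), s + v * c) * c) (at v)" for v
  proof -
    have "((\<lambda>v. (c + v * (- s), s + v * c)) has_derivative (\<lambda>v. (v * (- s), v * c))) (at v)"
      by (auto intro!: derivative_eq_intros)
    from has_derivative_compose[OF this eval2_has_derivative[of g]]
    show ?thesis unfolding has_field_derivative_def q_def[abs_def]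
      by (rule has_derivative_eq_rhs) (auto simp: fun_eq_iff algebra_simps)
  qed
  have q1: "q v = \<phi> 0 * v ^ n" if "v \<noteq> 0" for v
  proof -
    have "(c + v * (- s), s + v * c) = (v * (- s + (1 / v) * c), v * (c + (1 / v) * s))"
      using that by (simp add: algebra_simps)
    then have "q v = v ^ n * \<phi> (1 / v)" using scale by (simp add: q_def \<phi>_def)
    then show ?thesis using const by simp
  qed
  have "isCont q 0" using q' by (rule DERIV_isCont)
  then have "q \<midarrow>0\<rightarrow> q 0" by (simp add: isCont_def)
  moreover have "(\<lambda>v. \<phi> 0 * v ^ n) \<midarrow>0\<rightarrow> \<phi> 0 * 0 ^ n" by (intro tendsto_intros)
  then have "q \<midarrow>0\<rightarrow> \<phi> 0 * 0 ^ n" by (rule Lim_transform_eventually) (auto simp: eventually_at_filter q1)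
  ultimately have q0: "q 0 = 0" using LIM_unique n by fastforce
  then have "q v = \<phi> 0 * v ^ n" for v using q1[of v] n by (cases "v = 0") auto
  then have "q = (\<lambda>v. \<phi> 0 * v ^ n)" by (simp add: fun_eq_iff)
  moreover have "((\<lambda>v. \<phi> 0 * v ^ n) has_real_derivative \<phi> 0 * (real n * 0 ^ (n - Suc 0))) (at 0)"
    by (auto intro!: derivative_eq_intros)
  ultimately have "eval2 (dx g) (c, s) * (- s) + eval2 (dy g) (c, s) * c = \<phi> 0 * (real n * 0 ^ (n - Suc 0))"
    using q'[of 0] DERIV_unique by fastforce
  then have e1: "eval2 (dx g) (c, s) * (- s) + eval2 (dy g) (c, s) * c = 0" using n by simp
  have e2: "eval2 g (c, s) = 0" using q0 by (simp add: q_def)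
  then have e3: "c * eval2 (dx g) (c, s) + s * eval2 (dy g) (c, s) = 0"
    using euler_hom_part[of "(c, s)" n f] by (simp add: g_def)
  have "eval2 (dx g) (c, s) * (c * c + s * s) = 0" "eval2 (dy g) (c, s) * (c * c + s * s) = 0"
    using e1 e3 by algebra+
  then have "eval2 (dx g) (c, s) = 0" "eval2 (dy g) (c, s) = 0" using cs by auto
  moreover have "(c, s) \<noteq> 0" using cs by (auto simp: zero_prod_def)
  ultimately show False using simple[of "(c, s)"] e2 by (simp add: g_def)
qed

lemma scaled_limit_sum: "(\<Sum>k\<le>d. (0::real) ^ (d - k) * c k) = c d"
proof -
  have "(\<Sum>k\<le>d. (0::real) ^ (d - k) * c k) = (\<Sum>k\<le>d. if k = d then c d else 0)"
    by (intro sum.cong) auto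
  then show ?thesis by simp
qed

text \<open>Rescaled second derivatives join the circle of radius \<open>R\<close> to the leading
  form without zeros of \<open>spin\<close>. There \<open>spin\<close> times \<open>z^(-2)\<close>
  deforms into \<open>F + i F'\<close>, whose winding number is at most -2.\<close>

lemma spin_log_at_infinity:
  assumes n: "n \<ge> 2" and deg: "total_degree f = n"
    and sf: "simple_real_factors (hom_part n f)"
    and R: "R > 0" and hyp: "\<And>z. R \<le> cmod z \<Longrightarrow> eval2 (hess f) (plane_point z) < 0"
  obtains k where "has_log (sphere 0 R) (\<lambda>z. spin f z * z ^ k)"
proof -
  define g where "g = hom_part n f"
  have simple: "\<not> (eval2 g e = 0 \<and> eval2 (dx g) e = 0 \<and> eval2 (dy g) e = 0)" if "e \<noteq> 0" for e
    using simple_real_factors_no_critical_zero[OF sf that] by (simp add: g_def)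
  define d where "d = n - 2"
  have nd: "n = Suc (Suc d)" using n by (simp add: d_def)
  \<comment> \<open>the second derivatives at \<open>z / s\<close>, rescaled so that they extend to \<open>s = 0\<close>\<close>
  define S where "S p s z = (\<Sum>k\<le>d. s ^ (d - k) * eval2 (hom_part k p) (plane_point z))"
    for p and s :: real and z
  have S_cont: "continuous_on X (\<lambda>q. S p (a q) (b q))"
    if "continuous_on X a" "continuous_on X b" for X p and a :: "'b::topological_space \<Rightarrow> real" and b
    unfolding S_def by (intro continuous_intros that)
  have coeffs: "i + j \<le> d"
    if "coeff (coeff p j) i \<noteq> 0" "p = dx (dx f) \<or> p = dx (dy f) \<or> p = dy (dy f)" for p i j
  proof -
    have "coeff (coeff f j) (Suc (Suc i)) \<noteq> 0 \<or> coeff (coeff f (Suc j)) (Suc i) \<noteq> 0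
        \<or> coeff (coeff f (Suc (Suc j))) i \<noteq> 0"
      using that by (auto simp: coeff_dx coeff_dy)
    then show ?thesis
      using coeff_eq_0_above_total_degree[of f] deg nd by fastforce
  qed
  have S_eq: "S p s z = s ^ d * eval2 p (plane_point (z / of_real s))"
    if "p = dx (dx f) \<or> p = dx (dy f) \<or> p = dy (dy f)" "s \<noteq> 0" for p s z
  proof -
    have "s ^ d * eval2 p ((1 / s) *\<^sub>R plane_point z) = S p s z"
      unfolding S_def by (rule eval2_expand) (use coeffs that in blast)+
    moreover have "(1 / s) *\<^sub>R plane_point z = plane_point (z / of_real s)" by simp
    ultimately show ?thesis by metis
  qed
  have S0: "S p 0 z = eval2 (hom_part d p) (plane_point z)" for p z
    unfolding S_def by (rule scaled_limit_sum)
  have S0': "S (dx (dx f)) 0 z = eval2 (dx (dx g)) (plane_point z)"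
    "S (dx (dy f)) 0 z = eval2 (dx (dy g)) (plane_point z)"
    "S (dy (dy f)) 0 z = eval2 (dy (dy g)) (plane_point z)" for z
    unfolding S0 g_def nd dx_hom_part dy_hom_part by (rule refl)+
  \<comment> \<open>The rescaled Hessian: negative for small \<open>s > 0\<close>, hence nonpositive
    at \<open>s = 0\<close>.\<close>
  define Q where "Q s z = S (dx (dx f)) s z * S (dy (dy f)) s z - (S (dx (dy f)) s z)\<^sup>2" for s z
  have Q_neg: "Q s z < 0" if "0 < s" "R * s \<le> cmod z" for s z
  proof -
    have "R \<le> cmod (z / of_real s)" using that by (simp add: norm_divide pos_le_divide_eq)
    from hyp[OF this] have "s ^ d * s ^ d * eval2 (hess f) (plane_point (z / of_real s)) < 0"
      using that by (simp add: mult_pos_neg)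
    moreover have "Q s z = s ^ d * s ^ d * eval2 (hess f) (plane_point (z / of_real s))"
      using that by (simp add: Q_def S_eq eval2_hess algebra_simps power2_eq_square)
    ultimately show ?thesis by simp
  qed
  have Q0: "Q 0 z \<le> 0" if "z \<noteq> 0" for z
  proof (rule tendsto_upperbound)
    have "continuous_on UNIV (\<lambda>s. Q s z)" unfolding Q_def by (intro continuous_intros S_cont)
    then have "isCont (\<lambda>s. Q s z) 0" by (simp add: continuous_on_eq_continuous_at)
    then show "((\<lambda>s. Q s z) \<longlongrightarrow> Q 0 z) (at_right 0)"
      unfolding isCont_def by (rule tendsto_within_subset) auto
    have "cmod z / R > 0" using that R by simp
    then show "\<forall>\<^sub>F s in at_right 0. Q s z \<le> 0"
      unfolding eventually_at_right_field using R
      by (intro exI[of _ "cmod z / R"]) (auto intro!: less_imp_le Q_neg simp: field_simps)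
  qed simp
  have Q0_hess: "Q 0 z = eval2 (hess g) (plane_point z)" for z
    by (simp add: Q_def S0' eval2_hess)
  have ghyp: "eval2 (hess g) q \<le> 0" if "q \<noteq> 0" for q
    using Q0[of "Complex (fst q) (snd q)"] that unfolding Q0_hess by (auto simp: complex_eq_iff prod_eq_iff)
  define W where "W s z = Complex (S (dx (dx f)) s z - S (dy (dy f)) s z) (2 * S (dx (dy f)) s z)" for s z
  have W_cont: "continuous_on X (\<lambda>q. W (a q) (b q))"
    if "continuous_on X a" "continuous_on X b" for X and a :: "'b::topological_space \<Rightarrow> real" and b
    unfolding W_def by (intro continuous_intros S_cont that)
  \<comment> \<open>Where \<open>W\<close> vanishes, \<open>Q\<close> is the square of
    \<open>A\<close>, against \<open>Q < 0\<close> if \<open>s > 0\<close>. For \<open>s = 0\<close>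
    all second derivatives of the leading form vanish, and Euler's identities make \<open>z\<close>
    a critical zero.\<close>
  have W_nz: "W s z \<noteq> 0" if s: "0 \<le> s" "s \<le> 1 / R" and z: "cmod z = 1" for s z
  proof
    assume W: "W s z = 0"
    define A where "A = S (dx (dx f)) s z"
    have ABC: "S (dy (dy f)) s z = A" "S (dx (dy f)) s z = 0" using W by (auto simp: W_def A_def complex_eq_iff)
    then have Q: "Q s z = A * A" by (simp add: Q_def A_def)
    show False
    proof (cases "s = 0")
      case False
      then have "Q s z < 0" using s z R by (intro Q_neg) (auto simp: field_simps)
      then show False using Q by (simp add: mult_less_0_iff)
    next
      case True
      have "z \<noteq> 0" using z by auto
      then have "A * A \<le> 0" using Q0 Q True by metis
      then have "A = 0" by (auto simp: mult_le_0_iff)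
      define x y where "x = Re z" and "y = Im z"
      have "(real n - 1) * eval2 (dx g) (x, y) = 0" "(real n - 1) * eval2 (dy g) (x, y) = 0"
        using second_euler_hom_part[of n x f y] n ABC \<open>A = 0\<close> S0'[of z] unfolding True A_def g_def x_def y_def
        by auto
      then have gr: "eval2 (dx g) (x, y) = 0" "eval2 (dy g) (x, y) = 0" using n by auto
      then have "eval2 g (x, y) = 0" using euler_hom_part[of "(x, y)" n f] n by (simp add: g_def)
      moreover have "(x, y) \<noteq> 0" using \<open>z \<noteq> 0\<close> by (auto simp: x_def y_def complex_eq_iff zero_prod_def)
      ultimately show False using simple gr by blast
    qed
  qed
  define U where "U z = Complex (eval2 g (plane_point z)) (- Im z * eval2 (dx g) (plane_point z) + Re z * eval2 (dy g) (plane_point z))" for z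
  \<comment> \<open>On the unit circle \<open>(cnj z)^2\<close> is \<open>z^(-2)\<close>; this
    factor refers the Hessian matrix to the radial and tangential directions.\<close>
  define u where "u z = W 0 z * (cnj z)\<^sup>2" for z
  \<comment> \<open>The imaginary parts are \<open>T\<close> and \<open>2 m T\<close>, so a zero on
    the segment forces \<open>T = 0\<close>; then nonpositivity of the Hessian gives
    \<open>P\<close> and \<open>Re (u z)\<close> the same sign.\<close>
  have homotopic: "of_real (1 - t) * U z + of_real t * u z \<noteq> 0" if t: "0 \<le> t" "t \<le> 1" and z: "z \<in> sphere 0 1" for t z
  proof
    assume zero: "of_real (1 - t) * U z + of_real t * u z = 0"
    define x y where "x = Re z" and "y = Im z"
    have xy: "x * x + y * y = 1" using z cmod_power2[of z] by (simp add: x_def y_def power2_eq_square)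
    define A B C X Y P where "A = eval2 (dx (dx g)) (x, y)" and "B = eval2 (dx (dy g)) (x, y)"
      and "C = eval2 (dy (dy g)) (x, y)" and "X = eval2 (dx g) (x, y)" and "Y = eval2 (dy g) (x, y)"
      and "P = eval2 g (x, y)"
    define m where "m = real n - 1"
    have E: "x * A + y * B = m * X" "x * B + y * C = m * Y"
      using second_euler_hom_part[of n x f y] n unfolding g_def A_def B_def C_def X_def Y_def m_def by auto
    have E1: "x * X + y * Y = real n * P"
      using euler_hom_part[of "(x, y)" n f] unfolding g_def X_def Y_def P_def by simp
    define T where "T = - y * X + x * Y"
    have U: "Re (U z) = P" "Im (U z) = T" by (simp_all add: U_def P_def T_def X_def Y_def x_def y_def)
    have W0: "W 0 z = Complex (A - C) (2 * B)"
      by (simp add: W_def S0' A_def B_def C_def x_def y_def)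
    have cz: "Re ((cnj z)\<^sup>2) = x * x - y * y" "Im ((cnj z)\<^sup>2) = - 2 * x * y"
      by (simp_all add: power2_eq_square x_def y_def)
    have Reu: "Re (u z) = (A - C) * (x * x - y * y) + 4 * B * x * y"
      unfolding u_def W0 by (simp add: cz)
    have Imu: "Im (u z) = 2 * m * T"
    proof -
      have "Im (u z) = 2 * (x * (x * B + y * C) - y * (x * A + y * B))"
        unfolding u_def W0 by (simp add: cz algebra_simps)
      then show ?thesis unfolding E by (simp add: T_def algebra_simps)
    qed
    have m: "m \<ge> 1" using n by (simp add: m_def)
    have "((1 - t) + t * (2 * m)) * T = 0"
      using arg_cong[OF zero, of Im] U Imu by (simp add: algebra_simps)
    moreover have "(1 - t) + t * (2 * m) > 0"
    proof -
      have "t * (2 * m) \<ge> t * 2" using t m by (intro mult_left_mono) auto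
      then show ?thesis using t by linarith
    qed
    ultimately have T: "T = 0" by simp
    have "P \<noteq> 0"
    proof
      assume "P = 0"
      then have "x * X + y * Y = 0" "- y * X + x * Y = 0" using E1 T by (simp_all add: T_def)
      then have "(x * x + y * y) * X = 0" "(x * x + y * y) * Y = 0" by algebra+
      then have "X = 0" "Y = 0" using xy by auto
      moreover have "(x, y) \<noteq> 0" using xy by (auto simp: zero_prod_def)
      ultimately show False using simple[of "(x, y)"] \<open>P = 0\<close> by (simp add: P_def X_def Y_def)
    qed
    define Att where "Att = A * y * y - 2 * B * x * y + C * x * x"
    have "(x, y) \<noteq> 0" using xy by (auto simp: zero_prod_def)
    then have "A * C - B\<^sup>2 \<le> 0"
      using ghyp[of "(x, y)"] unfolding eval2_hess A_def B_def C_def by simp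
    then have le: "(A * C - B\<^sup>2) * (x * x + y * y)\<^sup>2 \<le> 0" by (simp add: mult_le_0_iff)
    \<comment> \<open>Gram determinant for the radial and tangential vectors; \<open>T = 0\<close>
      removes the mixed entry and leaves \<open>P * Att \<le> 0\<close>.\<close>
    have gram: "(A * C - B\<^sup>2) * (x * x + y * y)\<^sup>2
      = (x * (x * A + y * B) + y * (x * B + y * C)) * Att - (x * (x * B + y * C) - y * (x * A + y * B))\<^sup>2"
      by (simp add: Att_def algebra_simps power2_eq_square)
    have Azz: "x * (x * A + y * B) + y * (x * B + y * C) = m * (real n * P)"
      unfolding E E1[symmetric] by (simp add: algebra_simps)
    have Azt: "x * (x * B + y * C) - y * (x * A + y * B) = m * T"
      unfolding E by (simp add: T_def algebra_simps)
    have "m * real n * (P * Att) \<le> 0"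
      using le unfolding gram Azz Azt T by (simp add: mult_ac)
    moreover have "m * real n > 0" using m n by simp
    ultimately have PA: "P * Att \<le> 0" by (meson mult_pos_pos not_less)
    have Reu': "Re (u z) = m * (real n * P) - Att"
      unfolding Reu Azz[symmetric] by (simp add: Att_def algebra_simps)
    have "P * Re (u z) = m * real n * (P * P) - P * Att" unfolding Reu' by (simp add: algebra_simps)
    moreover have PP: "P * P > 0" using \<open>P \<noteq> 0\<close> by (simp add: zero_less_mult_iff) linarith
    have "m * real n * (P * P) > 0" by (rule mult_pos_pos) fact+
    ultimately have pu: "P * Re (u z) > 0" using PA by simp
    have "P * ((1 - t) * P + t * Re (u z)) = 0"
      using arg_cong[OF zero, of Re] U by simp
    then have "(1 - t) * (P * P) + t * (P * Re (u z)) = 0" by (simp add: algebra_simps)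
    moreover have "(1 - t) * (P * P) + t * (P * Re (u z)) > 0"
    proof (cases "t = 0")
      case True
      then show ?thesis using PP by simp
    next
      case False
      then have "t * (P * Re (u z)) > 0" "(1 - t) * (P * P) \<ge> 0" using pu t by simp_all
      then show ?thesis by linarith
    qed
    ultimately show False by simp
  qed
  have contU: "continuous_on (sphere 0 1) U" unfolding U_def by (intro continuous_intros)
  have contu: "continuous_on (sphere 0 1) u" unfolding u_def by (intro continuous_intros W_cont)
  have uU: "has_log (sphere 0 1) (\<lambda>z. u z / U z)"
    by (rule has_log_segment[OF contU contu homotopic])
  have Unz: "U z \<noteq> 0" if "z \<in> sphere 0 1" for z using homotopic[of 0 z] that by simp
  obtain t0 t1 where t01: "t0 < t1" "t1 < t0 + pi" "eval2 g (cos t0, sin t0) = 0" "eval2 g (cos t1, sin t1) = 0"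
    using hyperbolic_form_two_zero_directions[OF n simple[unfolded g_def] ghyp[unfolded g_def]] unfolding g_def by metis
  define F where "F t = eval2 g (cos t, sin t)" for t
  define F' where "F' t = - sin t * eval2 (dx g) (cos t, sin t) + cos t * eval2 (dy g) (cos t, sin t)" for t
  have F_deriv: "(F has_real_derivative F' t) (at t)" for t
  proof -
    have "((\<lambda>t. (cos t, sin t)) has_derivative (\<lambda>v. (v * - sin t, v * cos t))) (at t)"
      by (auto intro!: derivative_eq_intros)
    from has_derivative_compose[OF this eval2_has_derivative[of g]]
    show ?thesis unfolding has_field_derivative_def F_def[abs_def] F'_def
      by (rule has_derivative_eq_rhs) (auto simp: fun_eq_iff algebra_simps)
  qed
  have F'_cont: "continuous_on UNIV F'" unfolding F'_def by (intro continuous_intros)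
  have U_cis: "U (cis t) = Complex (F t) (F' t)" for t by (simp add: U_def F_def F'_def)
  have F_nz: "F t \<noteq> 0 \<or> F' t \<noteq> 0" for t using Unz[of "cis t"] U_cis[of t] by (auto simp: complex_eq_iff)
  have F_anti: "\<bar>F (t + pi)\<bar> = \<bar>F t\<bar>" for t
    using eval2_hom_part_scale[of n f "-1" "(cos t, sin t)"] by (simp add: F_def g_def abs_mult power_abs)
  obtain k where k: "has_log (sphere 0 1) (\<lambda>z. U z * z ^ (k + 2))"
    by (rule circle_winding_bound[of F F' U t0 t1])
      (use F_deriv F'_cont F_nz U_cis F_anti t01 in \<open>auto simp: F_def[symmetric]\<close>)
  from has_log_mult[OF uU k]
  have W0: "has_log (sphere 0 1) (\<lambda>z. W 0 z * z ^ k)"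
  proof (rule has_log_cong)
    fix z :: complex assume z: "z \<in> sphere 0 1"
    then have "cnj z * z = 1" using complex_norm_square[of z] by (simp add: mult.commute)
    then have "(cnj z)\<^sup>2 * z\<^sup>2 = 1" by (simp flip: power_mult_distrib)
    then show "W 0 z * z ^ k = u z / U z * (U z * z ^ (k + 2))"
      using Unz[OF z] by (simp add: u_def power_add mult_ac del: add_2_eq_Suc')
  qed
  \<comment> \<open>The homotopy moves \<open>s\<close> from 0, the leading form, to
    \<open>1 / R\<close>, the circle of radius \<open>R\<close>.\<close>
  have "has_log (sphere 0 1) (\<lambda>z. (\<lambda>p. W (fst p / R) (snd p)) (1, z) / (\<lambda>p. W (fst p / R) (snd p)) (0, z))"
  proof (rule has_log_homotopy)
    show "continuous_on ({0..1} \<times> sphere 0 1) (\<lambda>p. W (fst p / R) (snd p))"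
      by (intro W_cont continuous_intros) (use R in auto)
    show "W (fst (t, z) / R) (snd (t, z)) \<noteq> 0" if "t \<in> {0..1}" "z \<in> sphere 0 1" for t z
      using that R by (intro W_nz) (auto simp: divide_le_cancel)
  qed
  from has_log_mult[OF this W0]
  have "has_log (sphere 0 1) (\<lambda>z. W (1 / R) z * z ^ k)"
    by (rule has_log_cong) (use W_nz[of 0] R in auto)
  then obtain \<phi> where \<phi>: "continuous_on (sphere 0 1) \<phi>" "\<And>z. z \<in> sphere 0 1 \<Longrightarrow> W (1 / R) z * z ^ k = exp (\<phi> z)"
    unfolding has_log_def by blast
  have "has_log (sphere 0 R) (\<lambda>z. W (1 / R) (z / of_real R) * (z / of_real R) ^ k)"
  proof (rule has_logI)
    show "continuous_on (sphere 0 R) (\<lambda>z. \<phi> (z / of_real R))"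
      by (rule continuous_on_compose2[OF \<phi>(1)]) (use R in \<open>auto intro!: continuous_intros simp: norm_divide\<close>)
    show "W (1 / R) (z / of_real R) * (z / of_real R) ^ k = exp (\<phi> (z / of_real R))" if "z \<in> sphere 0 R" for z
      using that R by (intro \<phi>(2)) (simp add: norm_divide)
  qed
  from has_log_mult[OF this has_log_const[of "of_real R ^ (d + k)"]]
  have "has_log (sphere 0 R) (\<lambda>z. spin f z * z ^ k)"
  proof (rule has_log_cong)
    have "W (1 / R) (z / of_real R) = of_real ((1 / R) ^ d) * spin f z" for z
      using R by (simp add: W_def S_eq spin_def complex_eq_iff algebra_simps)
    then show "spin f z * z ^ k = W (1 / R) (z / of_real R) * (z / of_real R) ^ k * of_real R ^ (d + k)" for z
      using R by (simp add: power_divide power_add field_simps)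
  qed (use R in auto)
  then show thesis by (rule that)
qed

section \<open>Special parabolic points\<close>

text \<open>At a parabolic point \<open>(A - C) + 2 i B\<close> is the trace times the square of a
  unit eigenvector for the trace. The equations, with \<open>r > 0\<close>, put the gradient along
  that eigenvector, so the kernel of the Hessian matrix is tangent to the curve.\<close>

lemma special_parabolic_pointI:
  assumes gen: "generic_graph f" and h0: "eval2 (hess f) q = 0"
    and r: "r > 0"
    and w: "eval2 (dx (dx f)) q - eval2 (dy (dy f)) q = r * (eval2 (dx (dx f)) q + eval2 (dy (dy f)) q)
        * ((eval2 (dx (hess f)) q)\<^sup>2 - (eval2 (dy (hess f)) q)\<^sup>2)"
      "2 * eval2 (dx (dy f)) q = r * (eval2 (dx (dx f)) q + eval2 (dy (dy f)) q)
        * (2 * eval2 (dx (hess f)) q * eval2 (dy (hess f)) q)"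
  shows "q \<in> special_parabolic_points f"
proof -
  define A B C X Y where "A = eval2 (dx (dx f)) q" and "B = eval2 (dx (dy f)) q"
    and "C = eval2 (dy (dy f)) q" and "X = eval2 (dx (hess f)) q" and "Y = eval2 (dy (hess f)) q"
  define \<tau> where "\<tau> = A + C"
  have AC: "A * C = B * B" using h0 by (simp add: eval2_hess A_def B_def C_def power2_eq_square)
  have qp: "q \<in> parabolic_curve f" using h0 by (simp add: parabolic_curve_def)
  then have "hess_gradient f q \<noteq> 0" using gen by (simp add: generic_graph_def)
  then have XY: "X \<noteq> 0 \<or> Y \<noteq> 0" by (auto simp: hess_gradient_def X_def Y_def zero_prod_def)
  define M where "M = X * X + Y * Y"
  have M: "M > 0" using XY by (auto simp: M_def sum_squares_gt_zero_iff)
  have Q: "second_form f q v = A * (fst v * fst v) + 2 * B * fst v * snd v + C * (snd v * snd v)" for v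
    by (simp add: second_form_def A_def B_def C_def power2_eq_square)
  obtain v1 where "second_form f q v1 \<noteq> 0" using gen unfolding generic_graph_def by blast
  then have ABC: "\<not> (A = 0 \<and> B = 0 \<and> C = 0)" unfolding Q by auto
  have \<tau>: "\<tau> \<noteq> 0"
  proof
    assume "\<tau> = 0"
    then have C: "C = - A" by (simp add: \<tau>_def)
    then have "A * A + B * B = 0" using AC by algebra
    then show False using ABC C by (simp add: sum_squares_eq_zero_iff)
  qed
  have w1: "A - C = r * \<tau> * (X * X - Y * Y)" and w2: "2 * B = r * \<tau> * (2 * X * Y)"
    using w by (simp_all add: A_def B_def C_def X_def Y_def \<tau>_def power2_eq_square)
  \<comment> \<open>The vanishing determinant makes \<open>|\<tau>|\<close> the modulus of
    \<open>(A - C) + 2 i B\<close>; comparing moduli gives \<open>r * M = 1\<close>.\<close>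
  have "\<tau> * \<tau> = (A - C) * (A - C) + (2 * B) * (2 * B)" using AC by (simp add: \<tau>_def algebra_simps)
  also have "\<dots> = \<tau> * \<tau> * ((r * M) * (r * M))" unfolding w1 w2 M_def by (simp add: algebra_simps)
  finally have "(r * M) * (r * M) = 1" using \<tau> by simp
  moreover have "r * M > 0" using r M by simp
  ultimately have rM: "r * M = 1" by (simp add: square_eq_1_iff)
  define v where "v = (- Y, X)"
  have "2 * (A * (Y * Y) - 2 * B * X * Y + C * (X * X))
    = \<tau> * M - ((A - C) * (X * X - Y * Y) + 2 * (2 * B) * X * Y)"
    by (simp add: \<tau>_def M_def algebra_simps)
  also have "\<dots> = \<tau> * M * (1 - r * M)" unfolding w1 w2 by (simp add: M_def algebra_simps)
  finally have "A * (Y * Y) - 2 * B * X * Y + C * (X * X) = 0" unfolding rM by simp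
  then have Qv: "second_form f q v = 0" by (simp add: Q v_def algebra_simps)
  \<comment> \<open>\<open>A * C = B * B\<close> makes the form semidefinite up to sign, so its null
    vectors lie in the kernel of the matrix.\<close>
  have rows: "A * fst w + B * snd w = 0 \<and> B * fst w + C * snd w = 0" if "second_form f q w = 0" for w
  proof -
    have "(A * fst w + B * snd w) * (A * fst w + B * snd w) = A * second_form f q w"
      "(B * fst w + C * snd w) * (B * fst w + C * snd w) = C * second_form f q w"
      unfolding Q using AC by algebra+
    then show ?thesis using that by simp
  qed
  have v0: "v \<noteq> 0" using XY by (auto simp: v_def zero_prod_def)
  have "w \<in> span {v}" if "asymptotic_direction f q w" for w
  proof -
    have "second_form f q w = 0" using that by (simp add: asymptotic_direction_def)
    then have w: "A * fst w + B * snd w = 0" "B * fst w + C * snd w = 0" using rows by auto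
    have v: "A * fst v + B * snd v = 0" "B * fst v + C * snd v = 0" using rows[OF Qv] by auto
    have "A * (fst v * snd w - snd v * fst w) = 0" "B * (fst v * snd w - snd v * fst w) = 0"
      "C * (fst v * snd w - snd v * fst w) = 0"
      using v w by algebra+
    then have "fst v * snd w = snd v * fst w" using ABC by auto
    then have "X * fst w = - Y * snd w" by (simp add: v_def)
    then have "fst w * M = (X * snd w - Y * fst w) * - Y" "snd w * M = (X * snd w - Y * fst w) * X"
      unfolding M_def by algebra+
    then have "fst w = (X * snd w - Y * fst w) * - Y / M" "snd w = (X * snd w - Y * fst w) * X / M"
      using M by (metis less_irrefl nonzero_eq_divide_eq)+
    then have "w = ((X * snd w - Y * fst w) / M) *\<^sub>R v"
      unfolding prod_eq_iff v_def by simp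
    then show ?thesis by (metis span_mul span_base singletonI)
  qed
  moreover have "asymptotic_direction f q v" using v0 Qv by (simp add: asymptotic_direction_def)
  moreover have "tangent_to_parabolic_curve f q v"
    by (simp add: tangent_to_parabolic_curve_def hess_gradient_def inner_prod_def v_def X_def Y_def)
  ultimately show ?thesis using qp unfolding special_parabolic_points_def by blast
qed

text \<open>Genericity makes the curve a regular oval with nonvanishing trace, and the unbounded
  hyperbolic set puts the elliptic region inside; the two tangency points are then special.\<close>

theorem two_special_parabolic_points:
  assumes n: "n \<ge> 2" and deg: "total_degree f = n"
    and sf: "simple_real_factors (hom_part n f)" and gen: "generic_graph f"
    and conn: "connected (parabolic_curve f)" and comp: "compact (parabolic_curve f)"
    and ne: "parabolic_curve f \<noteq> {}" and unb: "\<not> bounded (hyperbolic_points f)"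
  obtains p q where "p \<noteq> q" "p \<in> special_parabolic_points f" "q \<in> special_parabolic_points f"
proof -
  define h where "h z = eval2 (hess f) (plane_point z)" for z
  define N where "N z = Complex (eval2 (dx (hess f)) (plane_point z)) (eval2 (dy (hess f)) (plane_point z))" for z
  define \<tau> where "\<tau> z = eval2 (dx (dx f)) (plane_point z) + eval2 (dy (dy f)) (plane_point z)" for z
  obtain R where R: "R > 0" "\<And>q. q \<in> parabolic_curve f \<Longrightarrow> norm q < R"
    using compact_imp_bounded[OF comp] by (metis bounded_pos_less)
  have norm_pp: "norm (plane_point z) = cmod z" for z
    by (simp add: norm_Pair cmod_def)
  have cont_h: "continuous_on X h" for X unfolding h_def by (intro continuous_intros)
  have nz: "h z \<noteq> 0" if "R \<le> cmod z" for z
    using R(2)[of "plane_point z"] that norm_pp[of z] by (auto simp: parabolic_curve_def h_def)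
  obtain q0 where q0: "q0 \<in> hyperbolic_points f" "R \<le> norm q0"
    using unb by (meson bounded_pos_less not_le boundedI less_imp_le)
  \<comment> \<open>\<open>h\<close> has no zero on the connected outside of the disc, and the
    hyperbolic point \<open>q0\<close> there decides its sign.\<close>
  have outside: "h z < 0" if z: "R \<le> cmod z" for z
  proof (rule ccontr)
    assume "\<not> h z < 0"
    then have "h z > 0" using nz[OF z] by simp
    define z0 where "z0 = Complex (fst q0) (snd q0)"
    have z0: "R \<le> cmod z0" "h z0 < 0"
      using q0 norm_pp[of z0] by (simp_all add: z0_def h_def hyperbolic_points_def)
    have "connected (- ball (0::complex) R)" by (intro connected_complement_bounded_convex) auto
    then have "is_interval (h ` (- ball 0 R))"
      unfolding is_interval_connected_1 by (rule connected_continuous_image[OF cont_h])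
    moreover have "h z \<in> h ` (- ball 0 R)" "h z0 \<in> h ` (- ball 0 R)" using z z0(1) by simp_all
    ultimately have "0 \<in> h ` (- ball 0 R)"
      using z0(2) \<open>h z > 0\<close> unfolding is_interval_1 by (meson less_imp_le)
    then obtain y where "0 = h y" "y \<in> - ball 0 R" by (rule imageE)
    then show False using nz[of y] by simp
  qed
  interpret plane_oval h N R
  proof
    show "(h has_derivative (\<lambda>v. N z \<bullet> v)) (at z)" for z
    proof -
      have "(plane_point has_derivative plane_point) (at z)"
        by (intro has_derivative_Pair bounded_linear_imp_has_derivative bounded_linear_Re bounded_linear_Im)
      from has_derivative_compose[OF this eval2_has_derivative[of "hess f"]]
      show ?thesis unfolding h_def[abs_def]
        by (rule has_derivative_eq_rhs) (auto simp: fun_eq_iff N_def inner_complex_def)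
    qed
    show "continuous_on UNIV N" unfolding N_def by (intro continuous_intros)
    have eq: "{z. h z = 0} = (\<lambda>q. Complex (fst q) (snd q)) ` parabolic_curve f"
      by (force simp: h_def parabolic_curve_def image_iff complex_eq_iff)
    show "connected {z. h z = 0}"
      unfolding eq by (intro connected_continuous_image conn continuous_intros)
    show "{z. h z = 0} \<noteq> {}" using ne unfolding eq by simp
    show "N z \<noteq> 0" if "h z = 0" for z
      using gen that unfolding generic_graph_def
      by (auto simp: N_def h_def parabolic_curve_def hess_gradient_def zero_prod_def complex_eq_iff)
    show "h z < 0" if "R \<le> cmod z" for z using outside that .
  qed
  obtain k where k: "has_log (sphere 0 R) (\<lambda>z. spin f z * z ^ k)"
    using spin_log_at_infinity[OF n deg sf R(1)] outside unfolding h_def by blast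
  have spin_cont: "continuous_on UNIV (spin f)" unfolding spin_def[abs_def] by (intro continuous_intros)
  have \<tau>_cont: "continuous_on UNIV \<tau>" unfolding \<tau>_def[abs_def] by (intro continuous_intros)
  have second_nz: "\<not> (eval2 (dx (dx f)) q = 0 \<and> eval2 (dx (dy f)) q = 0 \<and> eval2 (dy (dy f)) q = 0)" for q
  proof
    assume *: "eval2 (dx (dx f)) q = 0 \<and> eval2 (dx (dy f)) q = 0 \<and> eval2 (dy (dy f)) q = 0"
    obtain v where "second_form f q v \<noteq> 0" using gen unfolding generic_graph_def by blast
    then show False using * by (simp add: second_form_def)
  qed
  \<comment> \<open>A zero of \<open>spin f\<close> makes the Hessian matrix scalar, with a square
    as determinant; a nonpositive square would annihilate the second fundamental form, against
    genericity.\<close>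
  have spin_nz: "spin f z \<noteq> 0" if "h z \<le> 0" for z
  proof
    assume "spin f z = 0"
    then have e: "eval2 (dy (dy f)) (plane_point z) = eval2 (dx (dx f)) (plane_point z)"
      "eval2 (dx (dy f)) (plane_point z) = 0" by (simp_all add: spin_def complex_eq_iff)
    then have "(eval2 (dx (dx f)) (plane_point z))\<^sup>2 \<le> 0"
      using that by (simp add: h_def eval2_hess power2_eq_square)
    then show False using e second_nz[of "plane_point z"] by simp
  qed
  have \<tau>_nz: "\<tau> z \<noteq> 0" if "h z = 0" for z
  proof
    assume "\<tau> z = 0"
    then have e: "eval2 (dy (dy f)) (plane_point z) = - eval2 (dx (dx f)) (plane_point z)"
      by (simp add: \<tau>_def)
    then have "(eval2 (dx (dx f)) (plane_point z))\<^sup>2 + (eval2 (dx (dy f)) (plane_point z))\<^sup>2 = 0"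
      using that unfolding h_def eval2_hess by algebra
    then show False using e second_nz[of "plane_point z"] by simp
  qed
  have special: "plane_point z \<in> special_parabolic_points f"
    if z: "h z = 0" and ex: "\<exists>r>0. spin f z = of_real (r * \<tau> z) * (N z)\<^sup>2" for z
  proof -
    obtain r where r: "r > 0" and eq: "spin f z = of_real (r * \<tau> z) * (N z)\<^sup>2" using ex by blast
    show ?thesis
      by (rule special_parabolic_pointI[OF gen _ r])
        (use z arg_cong[OF eq, of Re] arg_cong[OF eq, of Im] in
          \<open>simp_all add: h_def spin_def \<tau>_def N_def power2_eq_square\<close>)
  qed
  obtain p q where pq: "p \<noteq> q" "h p = 0" "h q = 0"
    "\<exists>r>0. spin f p = of_real (r * \<tau> p) * (N p)\<^sup>2" "\<exists>r>0. spin f q = of_real (r * \<tau> q) * (N q)\<^sup>2"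
    by (rule two_tangency_points[OF spin_cont spin_nz \<tau>_cont \<tau>_nz k])
  have "plane_point p \<noteq> plane_point q" using pq(1) by (simp add: complex_eq_iff)
  then show thesis using special pq by (intro that)
qed

theorem corollary1:
  fixes n :: nat
  assumes "n \<ge> 3"
  shows "\<not> (\<exists>f :: bipoly.
            total_degree f = n
          \<and> simple_real_factors (hom_part n f)
          \<and> generic_graph f
          \<and> connected (parabolic_curve f) \<and> compact (parabolic_curve f)
          \<and> (\<exists>q. special_parabolic_points f = {q} \<and> special_index f q = 1)
          \<and> \<not> bounded (hyperbolic_points f))"
proof
  assume "\<exists>f :: bipoly.
            total_degree f = n
          \<and> simple_real_factors (hom_part n f)
          \<and> generic_graph f
          \<and> connected (parabolic_curve f) \<and> compact (parabolic_curve f)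
          \<and> (\<exists>q. special_parabolic_points f = {q} \<and> special_index f q = 1)
          \<and> \<not> bounded (hyperbolic_points f)"
  then obtain f q where f: "total_degree f = n" "simple_real_factors (hom_part n f)" "generic_graph f"
    "connected (parabolic_curve f)" "compact (parabolic_curve f)" "\<not> bounded (hyperbolic_points f)"
    and q: "special_parabolic_points f = {q}" by blast
  \<comment> \<open>The special point shows that the parabolic curve is nonempty.\<close>
  have "q \<in> parabolic_curve f" using q by (auto simp: special_parabolic_points_def)
  then have "parabolic_curve f \<noteq> {}" by blast
  then obtain a b where "a \<noteq> b" "a \<in> special_parabolic_points f" "b \<in> special_parabolic_points f"
    using two_special_parabolic_points[OF _ f(1-5) _ f(6)] assms by (metis Suc_leD eval_nat_numeral(3))
  then show False using q by simp
qed

end
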